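(* Fix integers $a\ge2$, $k\ge2$ and a real number $c>1/(k-1)$, and write $Q=q^a$. For all sufficiently small nonzero complex $q$, the formal series $x_0(q)$ (defined in the context) converges to a function analytic in $Q$ near zero, and the meromorphic continuation of $z\mapsto J(z,q)$ has exactly one pole in $|z|\le c/|Q|^2$. This pole is simple, with $$z_0(q)=\frac{x_0(q)}{Q^2}=-\frac{1+O(Q)}{(k-1)Q^2},\qquad \operatorname{Res}_{z=z_0}J(z,q)=-\frac{q^{1-a}\varrho(q)}{Q^2}.$$ For fixed positive $q$ sufficiently small, $z_0(q)<-1$ and, for any fixed $r_0$ with $|z_0(q)|<r_0<c/Q^2$, $$W_{a,d}(q,k)-T(q)=\frac{q^{1-a}\varrho(q)}{x_0(q)}\,\frac{z_0(q)^{-d}}{1-z_0(q)^{-d}}+O_{q,r_0}(r_0^{-d})\qquad(d\to\infty).$$ The leading error (the displayed main term) has sign $(-1)^{d-1}$ for all sufficiently large $d$.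
   Context: $\Phi(q)=\prod_{n\ge1}(1-q^n)$, $F(q)=\Phi(q)^k=1+\sum_{n\ge1}f_nq^n$ (so $f_1=-k$). For $0<|q|<1$, $$J(z,q)=\frac{\sum_{m\ge0}z^mq^{am+1}\Phi(q^{am+1})^k}{\sum_{m\ge0}z^mq^{a(m+1)}\Phi(q^{a(m+1)})^k},\quad W_{a,d}(q,k)=\frac1d\sum_{z^d=1}J(z,q),\quad T(q)=q^{1-a}\frac{\Phi(q)^k}{\Phi(q^a)^k};$$ both series defining $J$ converge for $|z|<|q|^{-a}$, and $J(\cdot,q)$ is then continued meromorphically in $z$. Put $$N(x,q)=(1-x)F(q)+f_1x(q-q^{1-a})+x(1-x)\sum_{n\ge2}f_n\frac{q^{n-a}(q^{an}-1)}{1-xq^{a(n-1)}},$$ $$M(x,q)=(1-x)F(q^a)+f_1x(q^a-1)+x(1-x)\sum_{n\ge2}f_n\frac{q^{a(n-1)}(q^{an}-1)}{1-xq^{a(n-1)}},$$ so that $J(z,q)=q^{1-a}N(zQ^2,q)/M(zQ^2,q)$. The formal root $x_0(q)$ is the unique element of $\mathbb Q[[q^a]]$ with $x_0(0)=1/(1+f_1)=-1/(k-1)$ and $M(x_0(q),q)=0$, and $\varrho(q)=-N(x_0(q),q)/M_x(x_0(q),q)$ with $M_x=\partial M/\partial x$. *)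

theory Defs
  imports "HOL-Complex_Analysis.Complex_Analysis" "HOL-Library.Landau_Symbols"
begin

definition euler_Phi :: "complex \<Rightarrow> complex" where
  "euler_Phi q = (\<Prod>n. 1 - q ^ Suc n)"

text \<open>
  The coefficients \<open>f\<^sub>n\<close> of \<open>F = \<Phi>\<^sup>k\<close> come from the formal Euler product, i.e. the infinite
  product and its limit are taken in the \<open>X\<close>-adic topology on \<open>\<rat>[[X]]\<close>.
\<close>

definition F_fps :: "nat \<Rightarrow> rat fps" where
  "F_fps k = (\<Prod>n. 1 - fps_X ^ Suc n) ^ k"

abbreviation fcoeff :: "nat \<Rightarrow> nat \<Rightarrow> rat" where
  "fcoeff k n \<equiv> fps_nth (F_fps k) n"

definition J_num :: "nat \<Rightarrow> nat \<Rightarrow> complex \<Rightarrow> complex \<Rightarrow> complex" where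
  "J_num a k z q = (\<Sum>m. z ^ m * q ^ (a * m + 1) * euler_Phi (q ^ (a * m + 1)) ^ k)"

definition J_den :: "nat \<Rightarrow> nat \<Rightarrow> complex \<Rightarrow> complex \<Rightarrow> complex" where
  "J_den a k z q = (\<Sum>m. z ^ m * q ^ (a * (m + 1)) * euler_Phi (q ^ (a * (m + 1))) ^ k)"

text \<open>Only meaningful for \<open>\<bar>z\<bar> < \<bar>q\<bar>\<^sup>-\<^sup>a\<close>, where both series converge.\<close>

definition J :: "nat \<Rightarrow> nat \<Rightarrow> complex \<Rightarrow> complex \<Rightarrow> complex" where
  "J a k z q = J_num a k z q / J_den a k z q"

text \<open>
  \<open>G\<close> is a meromorphic continuation of \<open>J(\<cdot>,q)\<close> to the whole plane. The library's
  \<open>meromorphic_on\<close> leaves the values at isolated points unconstrained, so \<open>G\<close> is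
  determined only up to such values; poles, orders and residues do not depend on them.
\<close>

definition J_continuation :: "nat \<Rightarrow> nat \<Rightarrow> complex \<Rightarrow> (complex \<Rightarrow> complex) \<Rightarrow> bool" where
  "J_continuation a k q G \<longleftrightarrow>
     G meromorphic_on UNIV \<and>
     (\<forall>z. norm z < 1 / norm q ^ a \<and> J_den a k z q \<noteq> 0 \<longrightarrow> G z = J a k z q)"

text \<open>The roots of unity satisfy \<open>\<bar>z\<bar> = 1 < \<bar>q\<bar>\<^sup>-\<^sup>a\<close>, so the series for \<open>J\<close> applies.\<close>

definition W :: "nat \<Rightarrow> nat \<Rightarrow> complex \<Rightarrow> nat \<Rightarrow> complex" where
  "W a d q k = (\<Sum>z | z ^ d = 1. J a k z q) / of_nat d"

definition T :: "nat \<Rightarrow> nat \<Rightarrow> complex \<Rightarrow> complex" where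
  "T a k q = q powi (1 - int a) * euler_Phi q ^ k / euler_Phi (q ^ a) ^ k"

definition N :: "nat \<Rightarrow> nat \<Rightarrow> complex \<Rightarrow> complex \<Rightarrow> complex" where
  "N a k x q =
     (1 - x) * euler_Phi q ^ k + of_rat (fcoeff k 1) * x * (q - q powi (1 - int a)) +
     x * (1 - x) * (\<Sum>n. if n < 2 then 0 else
        of_rat (fcoeff k n) * (q powi (int n - int a) * (q ^ (a * n) - 1))
          / (1 - x * q ^ (a * (n - 1))))"

definition M :: "nat \<Rightarrow> nat \<Rightarrow> complex \<Rightarrow> complex \<Rightarrow> complex" where
  "M a k x q =
     (1 - x) * euler_Phi (q ^ a) ^ k + of_rat (fcoeff k 1) * x * (q ^ a - 1) +
     x * (1 - x) * (\<Sum>n. if n < 2 then 0 else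
        of_rat (fcoeff k n) * (q ^ (a * (n - 1)) * (q ^ (a * n) - 1))
          / (1 - x * q ^ (a * (n - 1))))"

text \<open>
  \<open>M\<close> involves \<open>q\<close> only through \<open>Q = q\<^sup>a\<close>. Accordingly \<open>\<rat>[[q\<^sup>a]]\<close> is represented by
  \<open>rat fps\<close> with \<open>fps_X\<close> standing for \<open>Q\<close>. \<open>M_fps k x\<close> is \<open>M(x,q)\<close> for a formal series \<open>x\<close>;
  its infinite sum converges in the \<open>Q\<close>-adic topology, and each denominator has constant
  term \<open>1\<close>.
\<close>

definition M_fps :: "nat \<Rightarrow> rat fps \<Rightarrow> rat fps" where
  "M_fps k x =
     (1 - x) * F_fps k + fps_const (fcoeff k 1) * x * (fps_X - 1) +
     x * (1 - x) * (\<Sum>n. if n < 2 then 0 else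
        fps_const (fcoeff k n) * (fps_X ^ (n - 1) * (fps_X ^ n - 1))
          * inverse (1 - x * fps_X ^ (n - 1)))"

definition x0_fps :: "nat \<Rightarrow> rat fps" where
  "x0_fps k = (THE x. fps_nth x 0 = 1 / (1 + fcoeff k 1) \<and> M_fps k x = 0)"

definition complex_fps :: "rat fps \<Rightarrow> complex fps" where
  "complex_fps f = Abs_fps (\<lambda>n. of_rat (fps_nth f n))"

definition x0 :: "nat \<Rightarrow> nat \<Rightarrow> complex \<Rightarrow> complex" where
  "x0 a k q = eval_fps (complex_fps (x0_fps k)) (q ^ a)"

definition z0 :: "nat \<Rightarrow> nat \<Rightarrow> complex \<Rightarrow> complex" where
  "z0 a k q = x0 a k q / (q ^ a)\<^sup>2"

definition varrho :: "nat \<Rightarrow> nat \<Rightarrow> complex \<Rightarrow> complex" where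
  "varrho a k q = - N a k (x0 a k q) q / deriv (\<lambda>x. M a k x q) (x0 a k q)"

definition main_term :: "nat \<Rightarrow> nat \<Rightarrow> complex \<Rightarrow> nat \<Rightarrow> complex" where
  "main_term a k q d =
     q powi (1 - int a) * varrho a k q / x0 a k q *
     (z0 a k q powi (- int d) / (1 - z0 a k q powi (- int d)))"

end

theory Submission
  imports Defs
begin

text \<open>
  Expanding \<open>\<Phi>\<^sup>k\<close> and summing over \<open>m\<close> first turns both series of \<open>J\<close> into Lambert series
  \<open>\<Sum>\<^sub>n f\<^sub>n w\<^sup>n\<^sup>+\<^sup>1 / (1 - z Q\<^sup>n\<^sup>+\<^sup>1)\<close> with \<open>w = q\<close> and \<open>w = Q\<close>; removing the poles at \<open>z = 1/Q\<close> and
  \<open>z = 1/Q\<^sup>2\<close> and putting \<open>x = z Q\<^sup>2\<close> gives \<open>N\<close> and \<open>M\<close>. On \<open>\<bar>x\<bar> \<le> c\<close> the function \<open>M\<close> is an \<open>O(Q)\<close>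
  perturbation of \<open>1 + (k - 1) x\<close>, so its zero is the fixed point of a contraction that depends
  holomorphically on \<open>Q\<close>; its Taylor series solves the formal equation, whose solution is unique
  and rational. Since \<open>N\<close> is dominated by \<open>k x q\<^sup>1\<^sup>-\<^sup>a\<close> there, the zero is a simple pole of \<open>J\<close>.
  Averaging over the \<open>d\<close>-th roots of unity keeps the Taylor coefficients whose index is a multiple
  of \<open>d\<close>: the principal part produces the main term, and the holomorphic remainder is controlled
  by Cauchy's estimate.
\<close>

section \<open>The formal equation\<close>

text \<open>The number \<open>1 + f 1 = 1 - k\<close> decides both halves of the argument. Up to
  sign it is the slope in \<open>x\<close> of the limit of \<open>M\<close> at \<open>Q = 0\<close>,
  by which the contraction divides, and it is the factor with which each new coefficient of a formal
  root enters the equation; \<open>k >= 2\<close> keeps it away from zero in both places.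

  Once the two nearest poles are gone, the remaining denominators \<open>1 - x Q^(n-1)\<close> with
  \<open>n >= 2\<close> vanish only for \<open>norm x >= 1 / norm Q\<close>. A condition of the type
  \<open>C * norm Q <= 1/2\<close> keeps them at least \<open>1/2\<close> in modulus, and together
  with absolute convergence of the series of \<open>F\<close> at one radius \<open>r\<close> this
  gives every estimate. Work takes place on a disc of radius \<open>c + 2\<close>, so that unit
  circles around points with \<open>norm x <= c\<close> still fit and the closed disc lies in an
  open domain of holomorphy.

  The function \<open>N\<close> blows up like \<open>q^(1-a)\<close>; it is therefore estimated
  after multiplication by \<open>q^(a-1)\<close>, when it tends to \<open>k x\<close>. Among the
  multiples of \<open>d\<close>, the index 0 contributes \<open>J\<close> at \<open>z = 0\<close>,
  which is \<open>T\<close>; this is why \<open>T\<close> is subtracted from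
  \<open>W\<close>.\<close>

lemma suminf_fps_nth:
  fixes t :: "nat \<Rightarrow> 'a::ab_group_add fps"
  assumes "\<And>n j. j + 1 < n \<Longrightarrow> fps_nth (t n) j = 0"
  shows "t sums (\<Sum>n. t n)" "fps_nth (\<Sum>n. t n) l = (\<Sum>n\<le>l+1. fps_nth (t n) l)"
proof -
  \<comment> \<open>Terms of order at least \<open>n - 1\<close> make every coefficient of the
    partial sums eventually constant, which is convergence in the X-adic topology. The order
    \<open>n - 1\<close>, not \<open>n\<close>, is the reason for the cutoff
    \<open>l + 1\<close>.\<close>
  define s where "s = Abs_fps (\<lambda>l. \<Sum>n\<le>l+1. fps_nth (t n) l)"
  have "t sums s"
    unfolding sums_def_le
  proof (rule tendsto_fpsI)
    fix l
    have "fps_nth (\<Sum>n\<le>m. t n) l = fps_nth s l" if "m \<ge> l + 1" for m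
    proof -
      have "fps_nth (\<Sum>n\<le>m. t n) l = (\<Sum>n\<le>m. fps_nth (t n) l)"
        by (simp add: fps_sum_nth)
      also have "\<dots> = (\<Sum>n\<le>l+1. fps_nth (t n) l)"
        by (rule sum.mono_neutral_right) (use that assms in auto)
      finally show ?thesis by (simp add: s_def)
    qed
    then show "\<forall>\<^sub>F m in sequentially. fps_nth (\<Sum>n\<le>m. t n) l = fps_nth s l"
      unfolding eventually_sequentially by blast
  qed
  then have "(\<Sum>n. t n) = s" by (rule sums_unique[symmetric])
  with \<open>t sums s\<close> show "t sums (\<Sum>n. t n)" "fps_nth (\<Sum>n. t n) l = (\<Sum>n\<le>l+1. fps_nth (t n) l)"
    by (simp_all add: s_def)
qed

text \<open>Over an arbitrary field, because the equation is needed twice: over \<open>rat\<close>,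
  where \<open>x0_fps\<close> is defined, and over \<open>complex\<close>, where the Taylor series
  of the analytic root lives.\<close>

definition S_term :: "(nat \<Rightarrow> 'a::field) \<Rightarrow> 'a fps \<Rightarrow> nat \<Rightarrow> 'a fps" where
  "S_term f x n = (if n < 2 then 0 else
     fps_const (f n) * (fps_X ^ (n - 1) * (fps_X ^ n - 1)) * inverse (1 - x * fps_X ^ (n - 1)))"

definition M_ser :: "(nat \<Rightarrow> 'a::field) \<Rightarrow> 'a fps \<Rightarrow> 'a fps" where
  "M_ser f x = (1 - x) * Abs_fps f + fps_const (f 1) * x * (fps_X - 1) +
     x * (1 - x) * (\<Sum>n. S_term f x n)"

lemma M_fps_eq_M_ser: "M_fps k x = M_ser (fcoeff k) x"
  by (simp add: M_fps_def M_ser_def S_term_def[abs_def] fps_nth_inverse)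

lemma S_term_nth_eq_0: "j + 1 < n \<Longrightarrow> fps_nth (S_term f x n) j = 0"
  by (simp add: S_term_def mult.assoc fps_mult_left_const_nth fps_X_power_mult_nth)

lemma S_term_sums:
  "S_term f x sums (\<Sum>n. S_term f x n)"
  "fps_nth (\<Sum>n. S_term f x n) j = (\<Sum>n\<le>j+1. fps_nth (S_term f x n) j)"
  by (rule suminf_fps_nth, erule S_term_nth_eq_0)+

text \<open>Agreement is gained one order further, up to \<open>j = l\<close>: for
  \<open>n >= 2\<close> the series \<open>x\<close> enters only through
  \<open>x * fps_X ^ (n - 1)\<close>, and the difference of the two inverses is a multiple of
  \<open>(x - y) * fps_X\<close>.\<close>

lemma S_term_diff_nth:
  assumes eq: "\<And>j. j < l \<Longrightarrow> fps_nth x j = fps_nth y j" and "j \<le> l"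
  shows "fps_nth (S_term f x n) j = fps_nth (S_term f y n) j"
proof (cases "n < 2")
  case False
  define p :: "'a fps" where "p = fps_X ^ (n - 1)"
  have p0: "fps_nth p 0 = 0" using False by (simp add: p_def)
  have u: "inverse (1 - x * p) * (1 - x * p) = 1" "inverse (1 - y * p) * (1 - y * p) = 1"
    by (rule inverse_mult_eq_1, simp add: p0)+
  obtain d where d: "x - y = fps_X ^ l * d"
    using eq by (intro that[of "fps_shift l (x - y)"])
      (simp add: fps_eq_iff fps_X_power_mult_nth)
  have "inverse (1 - x * p) - inverse (1 - y * p)
      = inverse (1 - x * p) * inverse (1 - y * p) * p * (x - y)"
    using u by algebra
  moreover have "p = fps_X * fps_X ^ (n - 2)"
    using False by (simp add: p_def flip: power_Suc)
  ultimately have *: "inverse (1 - x * p) - inverse (1 - y * p)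
      = fps_X ^ Suc l * (inverse (1 - x * p) * inverse (1 - y * p) * fps_X ^ (n - 2) * d)"
    using d by (simp add: mult_ac)
  have "S_term f x n - S_term f y n
      = fps_const (f n) * (p * (fps_X ^ n - 1)) * (inverse (1 - x * p) - inverse (1 - y * p))"
    using False by (simp add: S_term_def p_def algebra_simps)
  also have "\<dots> = fps_X ^ Suc l * (fps_const (f n) * (p * (fps_X ^ n - 1)) *
      (inverse (1 - x * p) * inverse (1 - y * p) * fps_X ^ (n - 2) * d))"
    unfolding * by (simp only: mult_ac)
  finally have "fps_nth (S_term f x n - S_term f y n) j = 0"
    using \<open>j \<le> l\<close> by (simp only: fps_X_power_mult_nth) simp
  then show ?thesis by simp
qed (simp add: S_term_def)

text \<open>The equation is triangular. At the first order at which \<open>x\<close> and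
  \<open>y\<close> may differ, the infinite sum contributes nothing: its constant term is 0 and its
  own change has higher order. What is left is the constant term \<open>- f 0 - f 1\<close> of the
  cofactor of \<open>x - y\<close>.\<close>

lemma M_ser_diff_nth:
  assumes eq: "\<And>j. j < l \<Longrightarrow> fps_nth x j = fps_nth y j" and f0: "f 0 = 1"
  shows "fps_nth (M_ser f x - M_ser f y) l = - (1 + f 1) * (fps_nth x l - fps_nth y l)"
proof -
  let ?S = "\<lambda>x. \<Sum>n. S_term f x n"
  obtain d where d: "x - y = fps_X ^ l * d"
    using eq by (intro that[of "fps_shift l (x - y)"])
      (simp add: fps_eq_iff fps_X_power_mult_nth)
  have d0: "fps_nth d 0 = fps_nth x l - fps_nth y l"
    using arg_cong[OF d, of "\<lambda>z. fps_nth z l"] by (simp add: fps_X_power_mult_nth)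
  have "fps_nth (?S x) j = fps_nth (?S y) j" if "j \<le> l" for j
    unfolding S_term_sums(2) using that by (intro sum.cong refl S_term_diff_nth[OF eq]) auto
  then obtain e where e: "?S x - ?S y = fps_X ^ Suc l * e"
    by (intro that[of "fps_shift (Suc l) (?S x - ?S y)"])
      (simp add: fps_eq_iff fps_X_power_mult_nth del: power_Suc)
  have S0: "fps_nth (?S x) 0 = 0"
    unfolding S_term_sums(2) by (simp add: S_term_def)
  have "M_ser f x - M_ser f y = (x - y) * (- Abs_fps f + fps_const (f 1) * (fps_X - 1) +
      (1 - x - y) * ?S x) + y * (1 - y) * (?S x - ?S y)"
    by (simp add: M_ser_def algebra_simps)
  also have "\<dots> = fps_X ^ l * (d * (- Abs_fps f + fps_const (f 1) * (fps_X - 1) +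
      (1 - x - y) * ?S x)) + fps_X ^ Suc l * (y * (1 - y) * e)"
    unfolding d e by (simp only: mult_ac)
  finally show ?thesis
    by (simp add: fps_X_power_mult_nth d0 S0 f0 del: power_Suc)
qed

lemma M_ser_root_unique:
  assumes "M_ser f x = 0" "M_ser f y = 0" "f 0 = 1" "f 1 \<noteq> -1"
  shows "x = y"
proof (rule fps_ext)
  fix n show "fps_nth x n = fps_nth y n"
  proof (induction n rule: less_induct)
    case (less n)
    have "fps_nth (M_ser f x - M_ser f y) n = - (1 + f 1) * (fps_nth x n - fps_nth y n)"
      by (rule M_ser_diff_nth) (use less assms in auto)
    then show ?case
      using assms by (auto simp: add_eq_0_iff2)
  qed
qed

section \<open>Passage between rational and complex coefficients\<close>

lemma complex_fps_nth [simp]: "fps_nth (complex_fps x) n = of_rat (fps_nth x n)"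
  by (simp add: complex_fps_def)

lemma complex_fps_simps [simp]:
  "complex_fps (x + y) = complex_fps x + complex_fps y"
  "complex_fps (x - y) = complex_fps x - complex_fps y"
  "complex_fps (x * y) = complex_fps x * complex_fps y"
  "complex_fps 0 = 0" "complex_fps 1 = 1" "complex_fps fps_X = fps_X"
  "complex_fps (fps_const c) = fps_const (of_rat c)"
  by (simp_all add: fps_eq_iff of_rat_add of_rat_diff fps_mult_nth of_rat_sum of_rat_mult fps_X_def)

lemma complex_fps_power [simp]: "complex_fps (x ^ n) = complex_fps x ^ n"
  by (induction n) auto

lemma complex_fps_inj: "complex_fps x = complex_fps y \<longleftrightarrow> x = y"
  by (simp add: fps_eq_iff)

lemma complex_fps_inverse:
  assumes "fps_nth x 0 \<noteq> 0"
  shows "complex_fps (inverse x) = inverse (complex_fps x)"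
proof -
  have "complex_fps x * complex_fps (inverse x) = 1"
    using inverse_mult_eq_1'[OF assms] complex_fps_simps(3,5) by metis
  then show ?thesis
    by (metis fps_inverse_unique)
qed

text \<open>Each coefficient of the infinite sum is a finite sum, so the embedding commutes with it
  without any continuity argument.\<close>

lemma complex_fps_M_ser: "complex_fps (M_ser f x) = M_ser (\<lambda>n. of_rat (f n)) (complex_fps x)"
proof -
  have "complex_fps (S_term f x n) = S_term (\<lambda>n. of_rat (f n)) (complex_fps x) n" for n
    by (auto simp: S_term_def complex_fps_inverse)
  then have "complex_fps (\<Sum>n. S_term f x n) = (\<Sum>n. S_term (\<lambda>n. of_rat (f n)) (complex_fps x) n)"
    by (intro fps_ext) (simp only: S_term_sums(2) of_rat_sum complex_fps_nth flip: complex_fps_nth[of "S_term f x _"])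
  moreover have "complex_fps (Abs_fps f) = Abs_fps (\<lambda>n. of_rat (f n))"
    by (simp add: fps_eq_iff)
  ultimately show ?thesis
    by (simp add: M_ser_def)
qed

text \<open>The equation determines the coefficients of a root one after another, by rational operations.\<close>
lemma M_ser_root_rational:
  assumes root: "M_ser (\<lambda>n. of_rat (f n)) x = 0" and f: "f 0 = 1" "f 1 \<noteq> -1"
  obtains y where "complex_fps y = x"
proof -
  have "\<exists>c. fps_nth x n = of_rat c" for n
  proof (induction n rule: less_induct)
    case (less n)
    then obtain c where c: "\<And>j. j < n \<Longrightarrow> fps_nth x j = of_rat (c j)"
      by metis
    \<comment> \<open>The truncation of \<open>x\<close> below \<open>n\<close>: it has rational
      coefficients, and its \<open>n\<close>-th one is 0, so the difference formula isolates
      \<open>fps_nth x n\<close>.\<close>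
    define y where "y = Abs_fps (\<lambda>j. if j < n then c j else 0)"
    have "fps_nth (M_ser (\<lambda>n. of_rat (f n)) x - M_ser (\<lambda>n. of_rat (f n)) (complex_fps y)) n =
       - (1 + of_rat (f 1)) * (fps_nth x n - fps_nth (complex_fps y) n)"
      by (rule M_ser_diff_nth) (auto simp: y_def c f)
    then have "- of_rat (fps_nth (M_ser f y) n) = - (1 + of_rat (f 1)) * fps_nth x n"
      unfolding root by (simp add: y_def flip: complex_fps_M_ser)
    then have "of_rat (fps_nth (M_ser f y) n) = of_rat (1 + f 1) * fps_nth x n"
      unfolding of_rat_add of_rat_1 by algebra
    moreover have "1 + f 1 \<noteq> 0" using f by (simp add: add_eq_0_iff)
    ultimately have "fps_nth x n = of_rat (fps_nth (M_ser f y) n / (1 + f 1))"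
      by (simp add: of_rat_divide field_simps del: of_rat_add)
    then show ?case by blast
  qed
  then obtain c where "\<And>n. fps_nth x n = of_rat (c n)" by metis
  then show ?thesis by (intro that[of "Abs_fps c"]) (simp add: fps_eq_iff)
qed

text \<open>Resolves the \<open>THE\<close> in \<open>x0_fps\<close> from a complex root, which will
  be the Taylor series of the analytic one. The constant term prescribed in \<open>x0_fps\<close> is
  forced by the constant coefficient of the equation.\<close>

lemma x0_fps_eqI:
  assumes root: "M_ser (\<lambda>n. of_rat (fcoeff k n)) x = 0" and f: "fcoeff k 0 = 1" "fcoeff k 1 \<noteq> -1"
  shows "complex_fps (x0_fps k) = x"
proof -
  obtain y where y: "complex_fps y = x"
    using M_ser_root_rational assms by metis
  have My: "M_fps k y = 0"
    using root unfolding M_fps_eq_M_ser y[symmetric] complex_fps_M_ser[symmetric]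
    by (metis complex_fps_inj complex_fps_simps(4))
  have "fps_nth (M_fps k y) 0 = 1 - fps_nth y 0 * (1 + fcoeff k 1)"
    unfolding M_fps_eq_M_ser
    by (simp add: M_ser_def S_term_sums(2)) (simp add: S_term_def algebra_simps f)
  with My f have "fps_nth y 0 = 1 / (1 + fcoeff k 1)"
    by (simp add: field_simps add_eq_0_iff)
  then have "x0_fps k = y"
    unfolding x0_fps_def using M_ser_root_unique My f
    by (intro the_equality) (auto simp: M_fps_eq_M_ser)
  with y show ?thesis by simp
qed

section \<open>The expansion of Euler's product\<close>

text \<open>The factors with \<open>i > j\<close> are 1 modulo \<open>fps_X ^ (j + 2)\<close> and
  cannot change coefficient \<open>j\<close>.\<close>

lemma euler_fps_stable:
  fixes j n :: nat
  assumes "j \<le> n"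
  shows "fps_nth (\<Prod>i\<le>n. 1 - fps_X ^ Suc i :: 'a::idom fps) j = fps_nth (\<Prod>i\<le>j. 1 - fps_X ^ Suc i) j"
  using assms
proof (induction n rule: dec_induct)
  case (step n)
  define P :: "'a fps" where "P = (\<Prod>i\<le>n. 1 - fps_X ^ Suc i)"
  have "(\<Prod>i\<le>Suc n. 1 - fps_X ^ Suc i :: 'a fps) = P - fps_X ^ Suc (Suc n) * P"
    unfolding P_def prod.atMost_Suc right_diff_distrib mult_1_right by (simp only: mult.commute)
  moreover have "fps_nth (fps_X ^ Suc (Suc n) * P) j = 0"
    using step by (simp only: fps_X_power_mult_nth) simp
  ultimately show ?case
    using step.IH by (simp only: fps_sub_nth P_def diff_zero)
qed simp

definition euler_fps :: "rat fps" where
  "euler_fps = Abs_fps (\<lambda>j. fps_nth (\<Prod>i\<le>j. 1 - fps_X ^ Suc i) j)"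

lemma euler_fps_LIMSEQ: "(\<lambda>n. \<Prod>i\<le>n. 1 - fps_X ^ Suc i) \<longlonglongrightarrow> euler_fps"
proof (rule tendsto_fpsI)
  fix j
  show "\<forall>\<^sub>F n in sequentially. fps_nth (\<Prod>i\<le>n. 1 - fps_X ^ Suc i) j = fps_nth euler_fps j"
    using eventually_ge_at_top[of j]
    by eventually_elim (simp only: euler_fps_def fps_nth_Abs_fps, rule euler_fps_stable)
qed

lemma euler_fps_nth_0: "fps_nth euler_fps 0 = 1"
  and euler_fps_nth_1: "fps_nth euler_fps 1 = -1"
  by (simp_all add: euler_fps_def algebra_simps numeral_2_eq_2 fps_X_mult_nth)

lemma F_fps_eq: "F_fps k = euler_fps ^ k"
proof -
  \<comment> \<open>\<open>raw_has_prod\<close> demands a nonzero limit; the constant coefficient 1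
    of \<open>euler_fps\<close> supplies it.\<close>
  have "(\<lambda>n. 1 - fps_X ^ Suc n) has_prod euler_fps"
    using euler_fps_LIMSEQ euler_fps_nth_0
    by (auto simp: has_prod_def raw_has_prod_def)
  then show ?thesis
    unfolding F_fps_def by (metis has_prod_unique)
qed

lemma fcoeff_0: "fcoeff k 0 = 1"
  by (simp add: F_fps_eq fps_nth_power_0 euler_fps_nth_0)

lemma fcoeff_1: "fcoeff k 1 = - of_nat k"
proof (induction k)
  case (Suc k)
  have "fps_nth (euler_fps ^ Suc k) 1 =
      fps_nth euler_fps 0 * fps_nth (euler_fps ^ k) 1 + fps_nth euler_fps 1 * fps_nth (euler_fps ^ k) 0"
    by (simp only: power_Suc fps_mult_nth) simp
  also have "\<dots> = - of_nat (Suc k)"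
    using Suc.IH fcoeff_0[of k] unfolding F_fps_eq euler_fps_nth_0 euler_fps_nth_1 by simp
  finally show ?case unfolding F_fps_eq .
qed (simp add: F_fps_eq)

text \<open>Uniformity is what allows Taylor coefficients to be read off from the partial products.
  The radius \<open>1/2\<close> stands for any fixed radius below 1.\<close>

lemma euler_Phi_uniform_limit:
  "uniform_limit (cball 0 (1/2)) (\<lambda>n q. \<Prod>i<n. 1 - q ^ Suc i) euler_Phi sequentially"
proof -
  have "uniformly_convergent_on (cball 0 (1/2)) (\<lambda>n (q::complex). \<Prod>i<n. 1 - q ^ Suc i)"
  proof (rule uniformly_convergent_on_prod')
    show "uniformly_convergent_on (cball (0::complex) (1 / 2)) (\<lambda>l x. \<Sum>n<l. cmod (1 - x ^ Suc n - 1))"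
    proof (rule Weierstrass_m_test')
      fix n and x :: complex assume "x \<in> cball 0 (1/2)"
      then have "cmod x ^ Suc n \<le> (1/2) ^ Suc n" by (intro power_mono) auto
      then show "norm (cmod (1 - x ^ Suc n - 1)) \<le> (1/2) ^ Suc n"
        by (simp add: norm_mult norm_power)
    qed (use summable_Suc_iff[of "\<lambda>n. (1/2::real)^n"] summable_geometric[of "1/2::real"] in auto)
  qed (auto intro!: continuous_intros)
  then obtain l where l: "uniform_limit (cball 0 (1/2)) (\<lambda>n (q::complex). \<Prod>i<n. 1 - q ^ Suc i) l sequentially"
    unfolding uniformly_convergent_on_def by blast
  have "l q = euler_Phi q" if q: "q \<in> cball 0 (1/2)" for q
  proof -
    have lim: "(\<lambda>n. \<Prod>i<n. 1 - q ^ Suc i) \<longlonglongrightarrow> l q"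
      using tendsto_uniform_limitI[OF l q] .
    have "summable (\<lambda>i. norm (1 - q ^ Suc i - 1))"
      using summable_Suc_iff[of "\<lambda>n. norm q ^ n"] q summable_geometric[of "norm q"]
      by (simp add: norm_mult norm_power)
    then have "convergent_prod (\<lambda>i. 1 - q ^ Suc i)"
      by (intro abs_convergent_prod_imp_convergent_prod summable_imp_abs_convergent_prod)
    then have "(\<lambda>n. \<Prod>i\<le>n. 1 - q ^ Suc i) \<longlonglongrightarrow> euler_Phi q"
      unfolding euler_Phi_def by (rule convergent_prod_LIMSEQ)
    with lim show ?thesis
      by (metis LIMSEQ_lessThan_iff_atMost LIMSEQ_unique)
  qed
  then show ?thesis
    using l by (subst uniform_limit_cong'[of _ _ _ euler_Phi l]) auto
qed

text \<open>The finite products converge twice, uniformly near 0 and X-adically. Taylor coefficients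
  pass to a uniform limit, so the analytic and the formal limit correspond.\<close>

lemma euler_Phi_has_fps_expansion: "euler_Phi has_fps_expansion complex_fps euler_fps"
proof -
  let ?P = "\<lambda>n (q::complex). \<Prod>i<n. 1 - q ^ Suc i"
  have "euler_Phi holomorphic_on ball 0 (1/2)"
    by (rule holomorphic_uniform_limit[OF _ euler_Phi_uniform_limit])
      (auto intro!: holomorphic_intros continuous_intros always_eventually)
  then have exp: "euler_Phi has_fps_expansion fps_expansion euler_Phi 0"
    by (intro has_fps_expansion_fps_expansion[of "ball 0 (1/2)"]) auto
  have "(\<lambda>n. \<Prod>i<n. 1 - fps_X ^ Suc i) \<longlonglongrightarrow> euler_fps"
    by (subst LIMSEQ_lessThan_iff_atMost) (rule euler_fps_LIMSEQ)
  then have "(\<lambda>n. complex_fps (\<Prod>i<n. 1 - fps_X ^ Suc i)) \<longlonglongrightarrow> complex_fps euler_fps"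
    unfolding tendsto_fps_iff complex_fps_nth of_rat_eq_iff .
  moreover have "complex_fps (\<Prod>i<n. 1 - fps_X ^ Suc i) = (\<Prod>i<n. 1 - fps_X ^ Suc i)" for n
    by (induction n) auto
  ultimately have "(\<lambda>n. \<Prod>i<n. 1 - fps_X ^ Suc i) \<longlonglongrightarrow> complex_fps euler_fps"
    by simp
  then have "fps_expansion euler_Phi 0 = complex_fps euler_fps"
  proof (rule uniform_limit_imp_fps_expansion_eq)
    show "uniform_limit (ball 0 (1/2)) ?P euler_Phi sequentially"
      using euler_Phi_uniform_limit by (rule uniform_limit_on_subset) auto
    show "\<forall>\<^sub>F n in sequentially. ?P n has_fps_expansion (\<Prod>i<n. 1 - fps_X ^ Suc i)"
      by (intro always_eventually allI has_fps_expansion_prod has_fps_expansion_diff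
          has_fps_expansion_1 has_fps_expansion_fps_X_power)
    show "\<forall>\<^sub>F n in sequentially. ?P n holomorphic_on ball 0 (1/2)"
      by (intro always_eventually allI holomorphic_intros)
  qed (use exp in simp_all)
  with exp show ?thesis by simp
qed

text \<open>Produces the radius \<open>r\<close> to which all later estimates refer.\<close>

lemma euler_Phi_power_sums:
  obtains r :: real where "0 < r" "r < 1"
    "summable (\<lambda>n. norm (of_rat (fcoeff k n) :: complex) * r ^ n)"
    "\<And>w. norm w \<le> r \<Longrightarrow> (\<lambda>n. of_rat (fcoeff k n) * w ^ n) sums euler_Phi w ^ k"
proof -
  let ?E = "complex_fps (F_fps k)"
  have exp: "(\<lambda>w. euler_Phi w ^ k) has_fps_expansion ?E"
    unfolding F_fps_eq complex_fps_power
    by (induction k) (auto intro!: fps_expansion_intros euler_Phi_has_fps_expansion)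
  then obtain s where s: "s > 0" "\<And>w. norm w < s \<Longrightarrow> eval_fps ?E w = euler_Phi w ^ k"
    unfolding has_fps_expansion_def eventually_nhds_metric by auto
  from exp have R: "fps_conv_radius ?E > 0" by (simp add: has_fps_expansion_def)
  then obtain R where R: "0 < R" "ereal R < fps_conv_radius ?E"
    using ereal_dense2[of 0 "fps_conv_radius ?E"] by (auto simp: zero_ereal_def)
  \<comment> \<open>\<open>1/2\<close> gives \<open>r < 1\<close>, \<open>R\<close> lies strictly
    inside the disc of convergence, and \<open>s/2\<close> makes the closed disc of radius
    \<open>r\<close> lie in the region where the series represents the function.\<close>
  define r where "r = min (1/2) (min R (s/2))"
  have r: "0 < r" "r < 1" "ereal r < fps_conv_radius ?E" "r < s"
    using R s by (auto simp: r_def min_def intro: le_less_trans[OF _ R(2)])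
  show ?thesis
  proof (rule that[OF r(1,2)])
    have "summable (\<lambda>n. norm (fps_nth ?E n * of_real r ^ n))"
      using r by (intro abs_summable_in_conv_radius) (simp add: fps_conv_radius_def)
    then show "summable (\<lambda>n. norm (of_rat (fcoeff k n) :: complex) * r ^ n)"
      using r by (simp add: norm_mult norm_power)
    fix w :: complex assume w: "norm w \<le> r"
    have "(\<lambda>n. fps_nth ?E n * w ^ n) sums eval_fps ?E w"
      by (rule sums_eval_fps) (use w r in \<open>auto intro: le_less_trans[of _ "ereal r"]\<close>)
    also have "eval_fps ?E w = euler_Phi w ^ k"
      using s w r by auto
    finally show "(\<lambda>n. of_rat (fcoeff k n) * w ^ n) sums euler_Phi w ^ k"
      by simp
  qed
qed

section \<open>Holomorphic fixed points\<close>

text \<open>The common majorant argument for all Lambert-type sums: a denominator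
  \<open>1 - h\<close> with \<open>norm h <= 1/2\<close> costs at most a factor 2.\<close>

lemma fraction_series:
  fixes g h :: "nat \<Rightarrow> 'a \<Rightarrow> complex"
  assumes g: "\<And>n z. z \<in> U \<Longrightarrow> norm (g n z) \<le> b n" and b: "summable b"
    and h: "\<And>n z. z \<in> U \<Longrightarrow> norm (h n z) \<le> 1/2"
  shows "uniform_limit U (\<lambda>n z. \<Sum>i<n. g i z / (1 - h i z)) (\<lambda>z. \<Sum>i. g i z / (1 - h i z)) sequentially"
    and "z \<in> U \<Longrightarrow> summable (\<lambda>n. g n z / (1 - h n z))"
    and "z \<in> U \<Longrightarrow> norm (\<Sum>n. g n z / (1 - h n z)) \<le> 2 * (\<Sum>n. b n)"
proof -
  have le: "norm (g n z / (1 - h n z)) \<le> 2 * b n" if "z \<in> U" for n z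
  proof -
    have "1/2 \<le> norm (1 - h n z)"
      using norm_triangle_ineq2[of 1 "h n z"] h[OF that, of n] by simp
    then have "norm (g n z) / norm (1 - h n z) \<le> b n / (1/2)"
      by (intro frac_le) (use g[OF that, of n] order_trans[OF norm_ge_zero] in auto)
    then show ?thesis by (simp add: norm_divide)
  qed
  have b2: "summable (\<lambda>n. 2 * b n)" using b by (rule summable_mult)
  show "uniform_limit U (\<lambda>n z. \<Sum>i<n. g i z / (1 - h i z)) (\<lambda>z. \<Sum>i. g i z / (1 - h i z)) sequentially"
    using le b2 by (rule Weierstrass_m_test)
  assume "z \<in> U"
  then have le': "norm (g n z / (1 - h n z)) \<le> 2 * b n" for n by (rule le)
  show "summable (\<lambda>n. g n z / (1 - h n z))"
    by (rule summable_comparison_test'[OF b2]) (rule le')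
  have "norm (\<Sum>n. g n z / (1 - h n z)) \<le> (\<Sum>n. 2 * b n)"
    using b2 le' by (intro norm_suminf_le)
  also have "\<dots> = 2 * (\<Sum>n. b n)" using b by (rule suminf_mult)
  finally show "norm (\<Sum>n. g n z / (1 - h n z)) \<le> 2 * (\<Sum>n. b n)" .
qed

lemma holomorphic_on_uniform_limit_open:
  assumes "open U" "\<And>n. f n holomorphic_on U" "uniform_limit U f g sequentially"
  shows "g holomorphic_on U"
proof (rule holomorphic_uniform_sequence)
  fix z assume "z \<in> U"
  then obtain d where "0 < d" "cball z d \<subseteq> U" using \<open>open U\<close> open_contains_cball by blast
  then show "\<exists>d>0. cball z d \<subseteq> U \<and> uniform_limit (cball z d) f g sequentially"
    using assms(3) uniform_limit_on_subset by blast
qed fact+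

lemma fraction_series_holomorphic:
  fixes g h :: "nat \<Rightarrow> complex \<Rightarrow> complex"
  assumes "open U" "\<And>n. g n holomorphic_on U" "\<And>n. h n holomorphic_on U"
    and g: "\<And>n z. z \<in> U \<Longrightarrow> norm (g n z) \<le> b n" and b: "summable b"
    and h: "\<And>n z. z \<in> U \<Longrightarrow> norm (h n z) \<le> 1/2"
  shows "(\<lambda>z. \<Sum>n. g n z / (1 - h n z)) holomorphic_on U"
proof (rule holomorphic_on_uniform_limit_open)
  show "uniform_limit U (\<lambda>n z. \<Sum>i<n. g i z / (1 - h i z)) (\<lambda>z. \<Sum>i. g i z / (1 - h i z)) sequentially"
    by (rule fraction_series) fact+
  have "1 - h n z \<noteq> 0" if "z \<in> U" for n z
    using h[OF that, of n] by auto
  then show "(\<lambda>z. \<Sum>i<n. g i z / (1 - h i z)) holomorphic_on U" for n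
    using assms by (intro holomorphic_intros) auto
qed fact

text \<open>Cauchy's inequality on the unit circle around \<open>z\<close>; radius
  \<open>C + 2\<close> leaves room for the closed unit disc.\<close>

lemma bounded_holomorphic_deriv:
  assumes h: "h holomorphic_on ball 0 (C + 2)" and B: "\<And>x. norm x < C + 2 \<Longrightarrow> norm (h x) \<le> B"
    and z: "norm z \<le> C"
  shows "norm (deriv h z) \<le> B"
proof -
  have sub: "cball z 1 \<subseteq> ball 0 (C + 2)"
  proof
    fix w assume "w \<in> cball z 1"
    with z norm_triangle_sub[of w z] show "w \<in> ball 0 (C + 2)"
      by (simp add: dist_norm norm_minus_commute)
  qed
  have "norm ((deriv ^^ 1) h z) \<le> fact 1 * B / 1 ^ 1"
  proof (rule Cauchy_inequality)
    show "h holomorphic_on ball z 1" "continuous_on (cball z 1) h"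
      by (rule holomorphic_on_subset[OF h], use sub in force)
        (rule continuous_on_subset[OF holomorphic_on_imp_continuous_on[OF h] sub])
    fix w assume "norm (z - w) = 1"
    then have "w \<in> cball z 1" by (simp add: dist_norm)
    with sub have "norm w < C + 2" by auto
    then show "norm (h w) \<le> B" by (rule B)
  qed auto
  then show ?thesis by simp
qed

text \<open>This is how a mere sup bound on a perturbation turns into a contraction
  constant.\<close>

lemma bounded_holomorphic_lipschitz:
  assumes h: "h holomorphic_on ball 0 (C + 2)" and B: "\<And>x. norm x < C + 2 \<Longrightarrow> norm (h x) \<le> B"
    and xy: "norm x \<le> C" "norm y \<le> C"
  shows "norm (h x - h y) \<le> B * norm (x - y)"
proof (rule field_differentiable_bound[of "cball 0 C" _ "deriv h"])
  fix z :: complex assume z: "z \<in> cball 0 C"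
  then show "(h has_field_derivative deriv h z) (at z within cball 0 C)"
    by (intro DERIV_subset[OF holomorphic_derivI[OF h]]) auto
  show "norm (deriv h z) \<le> B"
    using z by (intro bounded_holomorphic_deriv[OF h B]) auto
qed (use xy in auto)

text \<open>The iterates of the contraction depend holomorphically on the parameter and converge uniformly.\<close>
lemma holomorphic_fixed_point:
  fixes R :: "complex \<Rightarrow> complex \<Rightarrow> complex"
  assumes lip: "\<And>Q x y. \<lbrakk>norm Q < \<delta>; norm x \<le> C; norm y \<le> C\<rbrakk> \<Longrightarrow> norm (R x Q - R y Q) \<le> norm (x - y) / 2"
    and bd: "\<And>Q x. \<lbrakk>norm Q < \<delta>; norm x \<le> C\<rbrakk> \<Longrightarrow> norm (R x Q) \<le> \<eta>" and c: "norm c + \<eta> \<le> C" "0 \<le> \<eta>"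
    and holo: "\<And>X. \<lbrakk>X holomorphic_on ball 0 \<delta>; \<And>Q. norm Q < \<delta> \<Longrightarrow> norm (X Q) \<le> C\<rbrakk>
       \<Longrightarrow> (\<lambda>Q. R (X Q) Q) holomorphic_on ball 0 \<delta>"
  obtains X where "X holomorphic_on ball 0 \<delta>" "\<And>Q. norm Q < \<delta> \<Longrightarrow> norm (X Q) \<le> C"
    "\<And>Q. norm Q < \<delta> \<Longrightarrow> X Q = c + R (X Q) Q"
proof -
  define Y where "Y = rec_nat (\<lambda>Q. c) (\<lambda>_ X Q. c + R (X Q) Q)"
  have Y0: "Y 0 Q = c" and YS: "Y (Suc n) Q = c + R (Y n Q) Q" for n Q
    by (simp_all add: Y_def)
  have Yb: "norm (Y n Q) \<le> C" if "norm Q < \<delta>" for n Q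
  proof (cases n)
    case 0 with c show ?thesis by (simp add: Y0)
  next
    case (Suc m)
    have "norm (Y m Q) \<le> C"
    proof (induction m)
      case (Suc m)
      then show ?case
        using norm_triangle_ineq[of c "R (Y m Q) Q"] bd[OF that Suc] c by (simp add: YS)
    qed (use c in \<open>simp add: Y0\<close>)
    then show ?thesis
      using norm_triangle_ineq[of c "R (Y m Q) Q"] bd[OF that, of "Y m Q"] c by (simp add: YS Suc)
  qed
  have Yh: "Y n holomorphic_on ball 0 \<delta>" for n
  proof (induction n)
    case (Suc n)
    then have "(\<lambda>Q. c + R (Y n Q) Q) holomorphic_on ball 0 \<delta>"
      by (intro holomorphic_intros holo Yb)
    then show ?case by (simp add: YS[abs_def])
  qed (simp add: Y0[abs_def])
  have step: "norm (Y (Suc n) Q - Y n Q) \<le> \<eta> * (1/2) ^ n" if "norm Q < \<delta>" for n Q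
  proof (induction n)
    case 0 then show ?case using bd[OF that, of c] c by (simp add: YS Y0)
  next
    case (Suc n)
    have "norm (Y (Suc (Suc n)) Q - Y (Suc n) Q) \<le> norm (Y (Suc n) Q - Y n Q) / 2"
      using lip[OF that Yb[OF that] Yb[OF that], of "Suc n" n] by (simp add: YS)
    with Suc show ?case by simp
  qed
  \<comment> \<open>The iterates are written as telescoping sums, so that the geometric bound
    \<open>step\<close> feeds the Weierstrass test.\<close>
  have "uniform_limit (ball 0 \<delta>) (\<lambda>n Q. \<Sum>i<n. Y (Suc i) Q - Y i Q) (\<lambda>Q. \<Sum>i. Y (Suc i) Q - Y i Q) sequentially"
    by (rule Weierstrass_m_test[where M = "\<lambda>n. \<eta> * (1/2)^n"])
      (use step in \<open>auto intro!: summable_mult summable_geometric\<close>)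
  then have lim0: "uniform_limit (ball 0 \<delta>) (\<lambda>n Q. c + (\<Sum>i<n. Y (Suc i) Q - Y i Q))
      (\<lambda>Q. c + (\<Sum>i. Y (Suc i) Q - Y i Q)) sequentially"
    by (intro uniform_limit_add uniform_limit_const)
  have tele: "c + (\<Sum>i<n. Y (Suc i) Q - Y i Q) = Y n Q" for n Q
    using sum_lessThan_telescope[of "\<lambda>i. Y i Q" n] Y0[of Q] by algebra
  define X where "X = (\<lambda>Q. c + (\<Sum>i. Y (Suc i) Q - Y i Q))"
  have lim: "uniform_limit (ball 0 \<delta>) Y X sequentially"
    using lim0 unfolding tele X_def .
  then have Xh: "X holomorphic_on ball 0 \<delta>"
    by (rule holomorphic_on_uniform_limit_open[OF open_ball Yh])
  have lim': "(\<lambda>n. Y n Q) \<longlonglongrightarrow> X Q" if "norm Q < \<delta>" for Q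
    using tendsto_uniform_limitI[OF lim, of Q] that by simp
  have Xb: "norm (X Q) \<le> C" if "norm Q < \<delta>" for Q
    using Lim_norm_ubound[OF _ lim'[OF that]] Yb[OF that] by (simp add: always_eventually)
  have "X Q = c + R (X Q) Q" if "norm Q < \<delta>" for Q
  proof -
    have le: "norm (R (Y n Q) Q - R (X Q) Q) \<le> norm (Y n Q - X Q) / 2" for n
      by (intro lip that Yb Xb)
    have "(\<lambda>n. norm (Y n Q - X Q) / 2) \<longlonglongrightarrow> 0"
      by (intro tendsto_divide_zero tendsto_norm_zero LIM_zero lim' that)
    then have "(\<lambda>n. R (Y n Q) Q - R (X Q) Q) \<longlonglongrightarrow> 0"
      by (rule Lim_null_comparison[OF always_eventually[OF allI[OF le]]])
    then have "(\<lambda>n. c + R (Y n Q) Q) \<longlonglongrightarrow> c + R (X Q) Q"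
      by (intro tendsto_add tendsto_const) (simp add: LIM_zero_iff)
    then have "(\<lambda>n. Y (Suc n) Q) \<longlonglongrightarrow> c + R (X Q) Q"
      by (simp add: YS)
    with LIMSEQ_Suc[OF lim'[OF that]] show ?thesis
      by (rule LIMSEQ_unique)
  qed
  with Xh Xb show ?thesis by (rule that)
qed

section \<open>Lambert series\<close>

text \<open>Isolates what the estimates use of the Euler product: absolute convergence at a radius
  below 1 and constant term 1. The value of \<open>f 1\<close> enters only through
  \<open>1 + f 1\<close>, in finding the root, and as the leading coefficient of the scaled
  numerator.\<close>

locale power_series =
  fixes f :: "nat \<Rightarrow> complex" and r :: real
  assumes r: "0 < r" "r < 1" and summable_r: "summable (\<lambda>n. norm (f n) * r ^ n)" and f_0: "f 0 = 1"
begin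

definition A :: real where "A = (\<Sum>n. norm (f n) * r ^ n)"

definition F :: "complex \<Rightarrow> complex" where "F w = (\<Sum>n. f n * w ^ n)"

definition S :: "complex \<Rightarrow> complex \<Rightarrow> complex \<Rightarrow> complex" where
  "S x w p = (\<Sum>n. if n < 2 then 0 else f n * (w ^ (n - 1) * (p ^ n - 1)) / (1 - x * p ^ (n - 1)))"

text \<open>With \<open>x = z Q\<^sup>2\<close>, the paper's \<open>M\<close> is the case \<open>u = 1\<close>, \<open>w = p = Q\<close>, and its \<open>N\<close> is the case
  \<open>u = q / Q\<close>, \<open>w = q\<close>, \<open>p = Q\<close>.\<close>
definition K :: "complex \<Rightarrow> complex \<Rightarrow> complex \<Rightarrow> complex \<Rightarrow> complex" where
  "K x u w p = (1 - x) * F w + u * x * (f 1 * (p - 1) + (1 - x) * S x w p)"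

lemma A_nonneg: "0 \<le> A"
  unfolding A_def using r by (intro suminf_nonneg summable_r) auto

lemma F_sums: "norm w \<le> r \<Longrightarrow> (\<lambda>n. f n * w ^ n) sums F w"
  unfolding F_def
proof (intro summable_sums summable_comparison_test'[OF summable_r])
  fix n assume "norm w \<le> r"
  then show "norm (f n * w ^ n) \<le> norm (f n) * r ^ n"
    unfolding norm_mult norm_power by (intro mult_left_mono power_mono) auto
qed

text \<open>For \<open>n >= 1\<close> one factor \<open>norm w / r\<close> splits off from each
  term, and what remains is dominated by the series \<open>A\<close>.\<close>

lemma F_bound:
  assumes "norm w \<le> r"
  shows "norm (F w - 1) \<le> A * norm w / r"
proof -
  have *: "norm (if n = 0 then 0 else f n * w ^ n) \<le> norm w / r * (norm (f n) * r ^ n)" for n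
  proof (cases n)
    case (Suc m)
    have "norm w * norm w ^ m \<le> norm w * r ^ m"
      using assms by (intro mult_left_mono power_mono) auto
    then have "norm (f n) * (norm w * norm w ^ m) \<le> norm (f n) * (norm w * r ^ m)"
      by (rule mult_left_mono) auto
    with Suc r show ?thesis by (simp add: norm_mult norm_power mult_ac)
  qed (use r in auto)
  have "(\<lambda>n. f n * w ^ n - (if n = 0 then 1 else 0)) sums (F w - 1)"
    by (rule sums_diff[OF F_sums[OF assms] sums_single[of 0 "\<lambda>_. 1"]])
  also have "(\<lambda>n. f n * w ^ n - (if n = 0 then 1 else 0)) = (\<lambda>n. if n = 0 then 0 else f n * w ^ n)"
    by (auto simp: f_0)
  finally have "F w - 1 = (\<Sum>n. if n = 0 then 0 else f n * w ^ n)"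
    by (rule sums_unique)
  also have "norm \<dots> \<le> (\<Sum>n. norm w / r * (norm (f n) * r ^ n))"
    using * by (rule norm_suminf_le) (rule summable_mult[OF summable_r])
  also have "\<dots> = A * norm w / r"
    using suminf_mult[OF summable_r, of "norm w / r"] by (simp add: A_def mult_ac)
  finally show ?thesis .
qed

lemma F_holomorphic: "F holomorphic_on ball 0 r"
proof (rule holomorphic_on_uniform_limit_open)
  show "uniform_limit (ball 0 r) (\<lambda>n w. \<Sum>i<n. f i * w ^ i) F sequentially"
    unfolding F_def
  proof (rule Weierstrass_m_test[OF _ summable_r])
    fix n and w :: complex assume "w \<in> ball 0 r"
    then show "norm (f n * w ^ n) \<le> norm (f n) * r ^ n"
      unfolding norm_mult norm_power by (intro mult_left_mono power_mono) auto
  qed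
qed (auto intro!: holomorphic_intros)

lemma F_has_fps_expansion: "F has_fps_expansion Abs_fps f"
proof (rule has_fps_expansionI)
  have "eventually (\<lambda>w. w \<in> ball 0 r) (nhds (0::complex))"
    using r by (intro eventually_nhds_in_open) auto
  then show "\<forall>\<^sub>F w in nhds 0. (\<lambda>n. fps_nth (Abs_fps f) n * w ^ n) sums F w"
    by eventually_elim (use F_sums in auto)
qed

text \<open>One factor of \<open>w ^ (n - 1)\<close> is bounded by \<open>\<rho>\<close> and the
  other \<open>n - 2\<close> by \<open>r\<close>, whence \<open>r\<^sup>2\<close> in the
  denominator; the 2 bounds \<open>p ^ n - 1\<close>. With \<open>\<rho> = norm w\<close> this shows
  that the sum is small, with \<open>\<rho> = r\<close> it is a majorant uniform in
  \<open>w\<close>.\<close>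

lemma S_numerator_bound:
  assumes "norm w \<le> \<rho>" "\<rho> \<le> r" "norm p \<le> 1"
  shows "norm (if n < 2 then 0 else f n * (w ^ (n - 1) * (p ^ n - 1)))
    \<le> 2 * \<rho> / r\<^sup>2 * (norm (f n) * r ^ n)"
proof (cases "n < 2")
  case False
  then obtain m where n: "n = Suc (Suc m)" by (metis Suc_diff_Suc Suc_1 diff_0_eq_0 less_2_cases_iff not_less_eq old.nat.exhaust)
  have "norm (w * w ^ m) \<le> \<rho> * r ^ m"
    using assms unfolding norm_mult norm_power
    by (intro mult_mono power_mono) (auto intro: order_trans[OF norm_ge_zero])
  moreover have "norm (p ^ n - 1) \<le> 2"
    using norm_triangle_ineq4[of "p ^ n" 1] power_le_one[of "norm p" n] assms
    by (simp add: norm_power)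
  moreover have "0 \<le> \<rho>" using assms(1) norm_ge_zero order_trans by blast
  ultimately have "norm (w * w ^ m) * norm (p ^ n - 1) \<le> (\<rho> * r ^ m) * 2"
    by (intro mult_mono) (use r \<open>0 \<le> \<rho>\<close> in auto)
  then have "norm (f n) * (norm (w * w ^ m) * norm (p ^ n - 1)) \<le> norm (f n) * ((\<rho> * r ^ m) * 2)"
    by (rule mult_left_mono) auto
  moreover have "norm (f n) * ((\<rho> * r ^ m) * 2) = 2 * \<rho> / r\<^sup>2 * (norm (f n) * r ^ n)"
    using r by (simp add: n power2_eq_square)
  ultimately show ?thesis using False by (simp add: n norm_mult)
next
  case True
  have "0 \<le> \<rho>" using assms(1) norm_ge_zero order_trans by blast
  with True r show ?thesis by simp
qed

lemma S_denominator_bound: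
  fixes x p :: complex
  assumes "norm (x * p) \<le> 1/2" "norm p \<le> 1"
  shows "norm (if n < 2 then 0 else x * p ^ (n - 1)) \<le> 1/2"
proof (cases "n < 2")
  case False
  then obtain m where n: "n = Suc (Suc m)" by (metis Suc_diff_Suc Suc_1 diff_0_eq_0 less_2_cases_iff not_less_eq old.nat.exhaust)
  have "norm (x * p) * norm p ^ m \<le> 1/2 * 1"
    using assms by (intro mult_mono power_le_one) auto
  with False show ?thesis by (simp add: n norm_mult norm_power mult.assoc)
qed auto

text \<open>Fits the sum to the pattern \<open>g / (1 - h)\<close>. For \<open>n < 2\<close> the
  truncated exponent \<open>n - 1\<close> is 0, and \<open>x\<close> itself can exceed
  \<open>1/2\<close> in modulus, so \<open>h\<close> is set to 0 there.\<close>

lemma S_alt: "S x w p = (\<Sum>n. (if n < 2 then 0 else f n * (w ^ (n - 1) * (p ^ n - 1))) /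
    (1 - (if n < 2 then 0 else x * p ^ (n - 1))))"
  unfolding S_def by (intro suminf_cong) simp

lemma S_majorant_summable: "summable (\<lambda>n. 2 * \<rho> / r\<^sup>2 * (norm (f n) * r ^ n))"
  by (rule summable_mult[OF summable_r])

lemma S_bound:
  assumes "norm w \<le> r" "norm p \<le> 1" "norm (x * p) \<le> 1/2"
  shows "norm (S x w p) \<le> 4 * A / r\<^sup>2 * norm w"
proof -
  have "norm (S x w p) \<le> 2 * (\<Sum>n. 2 * norm w / r\<^sup>2 * (norm (f n) * r ^ n))"
    unfolding S_alt
    by (rule fraction_series(3)[of "{()}" "\<lambda>n _. if n < 2 then 0 else f n * (w ^ (n - 1) * (p ^ n - 1))" _
          "\<lambda>n _. if n < 2 then 0 else x * p ^ (n - 1)" "()"])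
      (use assms in \<open>auto simp only: intro!: S_numerator_bound S_denominator_bound S_majorant_summable\<close>)
  also have "(\<Sum>n. 2 * norm w / r\<^sup>2 * (norm (f n) * r ^ n)) = 2 * norm w / r\<^sup>2 * A"
    unfolding A_def by (rule suminf_mult[OF summable_r])
  finally show ?thesis by (simp add: field_simps)
qed

lemma S_uniform_limit:
  assumes "\<And>t. t \<in> U \<Longrightarrow> norm (w t) \<le> r \<and> norm (p t) \<le> 1 \<and> norm (x t * p t) \<le> 1/2"
  shows "uniform_limit U (\<lambda>n t. \<Sum>i<n. if i < 2 then 0 else
    f i * (w t ^ (i - 1) * (p t ^ i - 1)) / (1 - x t * p t ^ (i - 1))) (\<lambda>t. S (x t) (w t) (p t)) sequentially"
proof -
  have "uniform_limit U (\<lambda>n t. \<Sum>i<n. (if i < 2 then 0 else f i * (w t ^ (i - 1) * (p t ^ i - 1))) /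
    (1 - (if i < 2 then 0 else x t * p t ^ (i - 1)))) (\<lambda>t. S (x t) (w t) (p t)) sequentially"
    unfolding S_alt
    by (rule fraction_series(1)) (use assms in \<open>auto simp only:
      intro!: S_numerator_bound[of _ r] S_denominator_bound S_majorant_summable\<close>)
  also have "(\<lambda>n t. \<Sum>i<n. (if i < 2 then 0 else f i * (w t ^ (i - 1) * (p t ^ i - 1))) /
      (1 - (if i < 2 then 0 else x t * p t ^ (i - 1)))) = (\<lambda>n t. \<Sum>i<n. if i < 2 then 0 else
      f i * (w t ^ (i - 1) * (p t ^ i - 1)) / (1 - x t * p t ^ (i - 1)))"
    by (intro ext sum.cong) auto
  finally show ?thesis .
qed

text \<open>All three arguments may vary, because holomorphy is wanted in \<open>x\<close> at fixed
  \<open>Q\<close> as well as in \<open>Q\<close> along a curve \<open>x = X Q\<close>.\<close>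

lemma S_holomorphic:
  assumes "open U" "x holomorphic_on U" "w holomorphic_on U" "p holomorphic_on U"
    and b: "\<And>t. t \<in> U \<Longrightarrow> norm (w t) \<le> r \<and> norm (p t) \<le> 1 \<and> norm (x t * p t) \<le> 1/2"
  shows "(\<lambda>t. S (x t) (w t) (p t)) holomorphic_on U"
  unfolding S_alt
proof (rule fraction_series_holomorphic[OF \<open>open U\<close>])
  show "(\<lambda>t. if n < 2 then 0 else f n * (w t ^ (n - 1) * (p t ^ n - 1))) holomorphic_on U" for n
    using assms by (cases "n < 2") (auto intro!: holomorphic_intros)
  show "(\<lambda>t. if n < 2 then 0 else x t * p t ^ (n - 1)) holomorphic_on U" for n
    using assms by (cases "n < 2") (auto intro!: holomorphic_intros)
  show "summable (\<lambda>n. 2 * r / r\<^sup>2 * (norm (f n) * r ^ n))" by (rule S_majorant_summable)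
qed (use b in \<open>auto simp only: intro!: S_numerator_bound S_denominator_bound\<close>)

lemma K_holomorphic:
  assumes "open U" "x holomorphic_on U" "w holomorphic_on U" "p holomorphic_on U"
    and b: "\<And>t. t \<in> U \<Longrightarrow> norm (w t) < r \<and> norm (p t) \<le> 1 \<and> norm (x t * p t) \<le> 1/2"
  shows "(\<lambda>t. K (x t) u (w t) (p t)) holomorphic_on U"
proof -
  have "(F \<circ> w) holomorphic_on U"
    by (rule holomorphic_on_compose_gen[OF \<open>w holomorphic_on U\<close> F_holomorphic]) (use b in auto)
  moreover have "(\<lambda>t. S (x t) (w t) (p t)) holomorphic_on U"
    using assms less_imp_le by (intro S_holomorphic) blast+
  ultimately show ?thesis
    unfolding K_def o_def using assms by (intro holomorphic_intros)
qed

text \<open>As \<open>p ^ n\<close> tends to 0, only finitely many denominators can vanish near a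
  given point. Those terms form a rational function; the others sum to a holomorphic one.\<close>

lemma S_meromorphic:
  assumes "norm w \<le> r" "norm p < 1"
  shows "(\<lambda>x. S x w p) meromorphic_on UNIV"
  unfolding meromorphic_on_meromorphic_at[of _ UNIV]
proof
  fix x0 :: complex
  have "(\<lambda>n. (norm x0 + 1) * norm p ^ n) \<longlonglongrightarrow> (norm x0 + 1) * 0"
    using assms by (intro tendsto_intros LIMSEQ_power_zero) auto
  then have "\<forall>\<^sub>F n in sequentially. (norm x0 + 1) * norm p ^ n < 1/2"
    by (rule order_tendstoD) auto
  then obtain m where m: "\<And>n. n \<ge> m \<Longrightarrow> (norm x0 + 1) * norm p ^ n < 1/2"
    unfolding eventually_sequentially by blast
  \<comment> \<open>The shift makes every remaining exponent \<open>n + l - 1\<close> at least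
    \<open>m\<close>, and it skips the vanishing terms with index below 2.\<close>
  define l where "l = m + 2"
  define t where "t = (\<lambda>x n. f n * (w ^ (n - 1) * (p ^ n - 1)) / (1 - x * p ^ (n - 1)))"
  have S_t: "S x w p = (\<Sum>n. if n < 2 then 0 else t x n)" for x
    unfolding S_def t_def ..
  have l: "m \<le> n + l - 1" "\<not> n + l < 2" for n
    by (simp_all add: l_def)
  let ?g = "\<lambda>n (x::complex). f (n + l) * (w ^ (n + l - 1) * (p ^ (n + l) - 1))"
  let ?h = "\<lambda>n x. x * p ^ (n + l - 1)"
  have g: "norm (?g n x) \<le> 2 * r / r\<^sup>2 * (norm (f (n + l)) * r ^ (n + l))" for n x
    using S_numerator_bound[of w r p "n + l"] assms unfolding if_not_P[OF l(2)] by auto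
  have b: "summable (\<lambda>n. 2 * r / r\<^sup>2 * (norm (f (n + l)) * r ^ (n + l)))"
    using S_majorant_summable[of r] by (subst summable_iff_shift)
  have h: "norm (?h n x) \<le> 1/2" if "x \<in> ball x0 1" for n x
  proof -
    have "norm x \<le> norm x0 + 1"
      using that norm_triangle_sub[of x x0] by (simp add: dist_norm norm_minus_commute)
    then have "norm (?h n x) \<le> (norm x0 + 1) * norm p ^ (n + l - 1)"
      unfolding norm_mult norm_power by (rule mult_right_mono) auto
    also have "\<dots> \<le> 1/2" using m[OF l(1)] by (rule less_imp_le)
    finally show ?thesis .
  qed
  have holo: "(\<lambda>x. \<Sum>n. ?g n x / (1 - ?h n x)) holomorphic_on ball x0 1"
    by (rule fraction_series_holomorphic[OF _ _ _ g b h]) (auto intro!: holomorphic_intros)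
  have split: "S x w p = (\<Sum>n. ?g n x / (1 - ?h n x)) + (\<Sum>n<l. if n < 2 then 0 else t x n)"
    if x: "x \<in> ball x0 1" for x
  proof -
    have "summable (\<lambda>n. ?g n x / (1 - ?h n x))"
      by (rule fraction_series(2)[OF g b h x])
    then have "summable (\<lambda>n. if n + l < 2 then 0 else t x (n + l))"
      unfolding if_not_P[OF l(2)] t_def .
    then have "summable (\<lambda>n. if n < 2 then 0 else t x n)"
      by (subst (asm) summable_iff_shift)
    from suminf_split_initial_segment[OF this, of l] show ?thesis
      unfolding S_t if_not_P[OF l(2)] by (simp only: t_def)
  qed
  have "(\<lambda>x. (\<Sum>n. ?g n x / (1 - ?h n x)) + (\<Sum>n<l. if n < 2 then 0 else t x n)) meromorphic_on ball x0 1"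
  proof (rule meromorphic_on_add)
    show "(\<lambda>x. \<Sum>n. ?g n x / (1 - ?h n x)) meromorphic_on ball x0 1"
      using holo by (intro analytic_on_imp_meromorphic_on) (simp add: analytic_on_open)
    show "(\<lambda>x. \<Sum>n<l. if n < 2 then 0 else t x n) meromorphic_on ball x0 1"
    proof (rule meromorphic_on_sum)
      show "(\<lambda>x. if n < 2 then 0 else t x n) meromorphic_on ball x0 1" for n
        unfolding t_def by (cases "n < 2") (auto intro!: meromorphic_intros)
    qed
  qed
  then have mero: "(\<lambda>x. (\<Sum>n. ?g n x / (1 - ?h n x)) + (\<Sum>n<l. if n < 2 then 0 else t x n)) meromorphic_on {x0}"
    by (rule meromorphic_on_subset) auto
  have "\<forall>\<^sub>F x in at x0. x \<in> ball x0 1"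
    by (intro eventually_at_in_open') auto
  then have "\<forall>\<^sub>F x in at x0. S x w p = (\<Sum>n. ?g n x / (1 - ?h n x)) + (\<Sum>n<l. if n < 2 then 0 else t x n)"
    by eventually_elim (rule split)
  then have "(\<lambda>x. S x w p) meromorphic_on {x0} \<longleftrightarrow>
      (\<lambda>x. (\<Sum>n. ?g n x / (1 - ?h n x)) + (\<Sum>n<l. if n < 2 then 0 else t x n)) meromorphic_on {x0}"
    by (intro meromorphic_on_cong refl) (simp only: singleton_iff)
  with mero show "(\<lambda>x. S x w p) meromorphic_on {x0}" by (rule iffD2[rotated])
qed

lemma K_meromorphic:
  assumes "norm w \<le> r" "norm p < 1"
  shows "(\<lambda>x. K x u w p) meromorphic_on UNIV"
  unfolding K_def by (intro meromorphic_intros S_meromorphic assms)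

text \<open>The order of summation is exchanged on partial sums: summing over \<open>m < l\<close>
  first gives finite geometric sums, and the error is at most
  \<open>A / \<delta> * norm (z * p) ^ l\<close>.\<close>

lemma lambert_sums:
  assumes w: "norm w \<le> r" and p: "norm p \<le> 1" and z: "norm (z * p) < 1"
  shows "summable (\<lambda>n. f n * w ^ (n + 1) / (1 - z * p ^ (n + 1)))"
    and "(\<lambda>m. z ^ m * (w * p ^ m) * F (w * p ^ m)) sums (\<Sum>n. f n * w ^ (n + 1) / (1 - z * p ^ (n + 1)))"
proof -
  \<comment> \<open>A lower bound for all denominators at once, since
    \<open>norm (z * p ^ (n + 1)) <= norm (z * p)\<close>.\<close>
  define \<delta> where "\<delta> = 1 - norm (z * p)"
  have "\<delta> > 0" using z by (simp add: \<delta>_def)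
  have zp: "norm (z * p ^ (n + 1)) \<le> norm (z * p)" for n
    using p mult_left_mono[OF power_le_one[of "norm p" n], of "norm (z * p)"]
    by (simp add: norm_mult norm_power mult.assoc)
  have den: "\<delta> \<le> norm (1 - z * p ^ (n + 1))" for n
    using norm_triangle_ineq2[of 1 "z * p ^ (n + 1)"] zp[of n] by (simp add: \<delta>_def)
  define g where "g = (\<lambda>n. f n * w ^ (n + 1) / (1 - z * p ^ (n + 1)))"
  have g_bound: "norm (g n) \<le> norm (f n) * r ^ n / \<delta>" for n
  proof -
    have "norm w ^ (n + 1) \<le> r ^ (n + 1)" using w by (intro power_mono) auto
    also have "\<dots> \<le> r ^ n" using r by (simp add: mult_left_le_one_le)
    finally have "norm (f n) * norm w ^ (n + 1) \<le> norm (f n) * r ^ n"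
      by (rule mult_left_mono) auto
    then show ?thesis
      unfolding g_def norm_divide norm_mult[of "f n"] norm_power using den[of n] \<open>\<delta> > 0\<close> r
      by (intro frac_le) auto
  qed
  have b: "summable (\<lambda>n. norm (f n) * r ^ n / \<delta>)"
    by (rule summable_divide[OF summable_r])
  then have g_sum: "summable g"
    by (rule summable_comparison_test') (rule g_bound)
  then show "summable (\<lambda>n. f n * w ^ (n + 1) / (1 - z * p ^ (n + 1)))"
    by (simp add: g_def)
  have wp: "norm (w * p ^ m) \<le> r" for m
    using mult_mono[OF w power_le_one[of "norm p" m]] p r by (simp add: norm_mult norm_power)
  have partial: "(\<lambda>n. g n - g n * (z * p ^ (n + 1)) ^ l) sums
      (\<Sum>m<l. z ^ m * (w * p ^ m) * F (w * p ^ m))" for l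
  proof -
    have "(\<lambda>n. \<Sum>m<l. z ^ m * (w * p ^ m) * (f n * (w * p ^ m) ^ n)) sums
        (\<Sum>m<l. z ^ m * (w * p ^ m) * F (w * p ^ m))"
      by (intro sums_sum sums_mult F_sums wp)
    also have "(\<lambda>n. \<Sum>m<l. z ^ m * (w * p ^ m) * (f n * (w * p ^ m) ^ n)) =
        (\<lambda>n. g n - g n * (z * p ^ (n + 1)) ^ l)"
    proof
      fix n
      define y where "y = z * p ^ (n + 1)"
      have "1 - y \<noteq> 0" using den[of n] \<open>\<delta> > 0\<close> by (auto simp: y_def)
      have "z ^ m * (w * p ^ m) * (f n * (w * p ^ m) ^ n) = f n * w ^ (n + 1) * y ^ m" for m
        unfolding y_def by (simp add: power_mult_distrib mult_ac power_add flip: power_mult power_Suc)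
      then have "(\<Sum>m<l. z ^ m * (w * p ^ m) * (f n * (w * p ^ m) ^ n)) =
          f n * w ^ (n + 1) * (\<Sum>m<l. y ^ m)"
        by (simp only: sum_distrib_left)
      also have "(\<Sum>m<l. y ^ m) = (1 - y ^ l) / (1 - y)"
        using \<open>1 - y \<noteq> 0\<close> sum_gp_strict[of y l] by simp
      also have "f n * w ^ (n + 1) * ((1 - y ^ l) / (1 - y)) = g n - g n * y ^ l"
        unfolding g_def y_def[symmetric] by (simp only: diff_divide_distrib right_diff_distrib) simp
      finally show "(\<Sum>m<l. z ^ m * (w * p ^ m) * (f n * (w * p ^ m) ^ n)) =
          g n - g n * (z * p ^ (n + 1)) ^ l" by (simp only: y_def)
    qed
    finally show ?thesis .
  qed
  have "(\<lambda>l. \<Sum>m<l. z ^ m * (w * p ^ m) * F (w * p ^ m)) \<longlonglongrightarrow> suminf g"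
  proof (rule LIM_zero_cancel, rule Lim_null_comparison)
    show "\<forall>\<^sub>F l in sequentially. norm ((\<Sum>m<l. z ^ m * (w * p ^ m) * F (w * p ^ m)) - suminf g)
        \<le> A / \<delta> * norm (z * p) ^ l"
    proof (intro always_eventually allI)
      fix l
      have s: "(\<lambda>n. g n * (z * p ^ (n + 1)) ^ l) sums
          (suminf g - (\<Sum>m<l. z ^ m * (w * p ^ m) * F (w * p ^ m)))"
        using sums_diff[OF summable_sums[OF g_sum] partial[of l]] by simp
      have "norm (g n * (z * p ^ (n + 1)) ^ l) \<le> norm (f n) * r ^ n / \<delta> * norm (z * p) ^ l" for n
        unfolding norm_mult[of "g n"] norm_power using g_bound[of n] zp[of n]
        by (intro mult_mono power_mono) (use r \<open>\<delta> > 0\<close> in auto)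
      then have "norm (\<Sum>n. g n * (z * p ^ (n + 1)) ^ l) \<le> (\<Sum>n. norm (f n) * r ^ n / \<delta> * norm (z * p) ^ l)"
        by (rule norm_suminf_le) (rule summable_mult2[OF b])
      also have "\<dots> = A / \<delta> * norm (z * p) ^ l"
        unfolding A_def suminf_divide[OF summable_r, symmetric] by (rule suminf_mult2[OF b, symmetric])
      finally show "norm ((\<Sum>m<l. z ^ m * (w * p ^ m) * F (w * p ^ m)) - suminf g) \<le> A / \<delta> * norm (z * p) ^ l"
        by (subst norm_minus_commute) (simp only: sums_unique[OF s])
    qed
    show "(\<lambda>l. A / \<delta> * norm (z * p) ^ l) \<longlonglongrightarrow> 0"
      using z by (intro tendsto_mult_right_zero LIMSEQ_power_zero) auto
  qed
  then show "(\<lambda>m. z ^ m * (w * p ^ m) * F (w * p ^ m)) sums (\<Sum>n. f n * w ^ (n + 1) / (1 - z * p ^ (n + 1)))"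
    by (simp add: sums_def g_def)
qed

text \<open>Multiplication by \<open>1 - z p\<close> removes the pole closest to the origin, because
  \<open>(1 - z p) / (1 - z p\<^sup>n\<^sup>+\<^sup>1) = 1 + z p (p\<^sup>n - 1) / (1 - z p\<^sup>n\<^sup>+\<^sup>1)\<close>.\<close>
lemma lambert_eq_K:
  assumes w: "norm w \<le> r" and p: "norm p \<le> 1" "p \<noteq> 0" and z: "norm (z * p) < 1"
  shows "(1 - z * p\<^sup>2) * (1 - z * p) * (\<Sum>n. f n * w ^ (n + 1) / (1 - z * p ^ (n + 1))) =
    w * K (z * p\<^sup>2) (w / p) w p"
proof -
  let ?D = "\<Sum>n. f n * w ^ (n + 1) / (1 - z * p ^ (n + 1))"
  define x where "x = z * p\<^sup>2"
  have ne: "1 - z * p ^ (n + 1) \<noteq> 0" for n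
  proof -
    have "norm (z * p ^ (n + 1)) \<le> norm (z * p)"
      using p mult_left_mono[OF power_le_one[of "norm p" n], of "norm (z * p)"]
      by (simp add: norm_mult norm_power mult.assoc)
    with z show ?thesis by auto
  qed
  have "(\<lambda>n. (1 - z * p) * (f n * w ^ (n + 1) / (1 - z * p ^ (n + 1))) - w * (f n * w ^ n)) sums
      ((1 - z * p) * ?D - w * F w)"
    by (intro sums_diff sums_mult summable_sums lambert_sums F_sums w z p)
  also have "(\<lambda>n. (1 - z * p) * (f n * w ^ (n + 1) / (1 - z * p ^ (n + 1))) - w * (f n * w ^ n)) =
     (\<lambda>n. w * z * p * (f n * w ^ n * (p ^ n - 1) / (1 - z * p ^ (n + 1))))"
    using ne by (intro ext) (simp add: divide_simps, simp add: algebra_simps)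
  finally have s1: "(\<lambda>n. w * z * p * (f n * w ^ n * (p ^ n - 1) / (1 - z * p ^ (n + 1)))) sums
      ((1 - z * p) * ?D - w * F w)" .
  \<comment> \<open>The term \<open>n = 1\<close> has denominator \<open>1 - z p^2 = 1 - x\<close>,
    the second pole to be removed, and is split off; the term \<open>n = 0\<close> vanishes because
    \<open>p ^ 0 - 1 = 0\<close>.\<close>
  have s2: "(\<lambda>n. if n = 1 then w * z * p * (f n * w ^ n * (p ^ n - 1) / (1 - z * p ^ (n + 1))) else 0) sums
      (w * z * p * (f 1 * w * (p - 1) / (1 - x)))"
    using sums_single[of 1 "\<lambda>n. w * z * p * (f n * w ^ n * (p ^ n - 1) / (1 - z * p ^ (n + 1)))"]
    by (simp add: x_def power2_eq_square)
  have "(\<lambda>n. w * z * p * (f n * w ^ n * (p ^ n - 1) / (1 - z * p ^ (n + 1))) -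
      (if n = 1 then w * z * p * (f n * w ^ n * (p ^ n - 1) / (1 - z * p ^ (n + 1))) else 0)) =
    (\<lambda>n. w\<^sup>2 * z * p * (if n < 2 then 0 else f n * (w ^ (n - 1) * (p ^ n - 1)) / (1 - x * p ^ (n - 1))))"
  proof
    fix n :: nat
    consider "n = 0" | "n = 1" | m where "n = Suc (Suc m)" by (metis One_nat_def not0_implies_Suc)
    then show "w * z * p * (f n * w ^ n * (p ^ n - 1) / (1 - z * p ^ (n + 1))) -
      (if n = 1 then w * z * p * (f n * w ^ n * (p ^ n - 1) / (1 - z * p ^ (n + 1))) else 0) =
      w\<^sup>2 * z * p * (if n < 2 then 0 else f n * (w ^ (n - 1) * (p ^ n - 1)) / (1 - x * p ^ (n - 1)))"
      by cases (simp_all add: x_def power2_eq_square mult_ac)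
  qed
  with sums_diff[OF s1 s2] have
    "(\<lambda>n. w\<^sup>2 * z * p * (if n < 2 then 0 else f n * (w ^ (n - 1) * (p ^ n - 1)) / (1 - x * p ^ (n - 1)))) sums
      ((1 - z * p) * ?D - w * F w - w * z * p * (f 1 * w * (p - 1) / (1 - x)))"
    by simp
  moreover have "(\<Sum>n. w\<^sup>2 * z * p * (if n < 2 then 0 else f n * (w ^ (n - 1) * (p ^ n - 1)) / (1 - x * p ^ (n - 1)))) =
      w\<^sup>2 * z * p * S x w p"
  \<comment> \<open>Summability of the inner series is known only after multiplication by this
    factor, which can be divided out unless it is 0.\<close>
  proof (cases "w\<^sup>2 * z * p = 0")
    case False
    with calculation show ?thesis
      unfolding S_def by (intro suminf_mult) (simp add: sums_iff summable_cmult_iff)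
  next
    case True
    show ?thesis by (simp only: True mult_zero_left suminf_zero)
  qed
  ultimately have "(1 - z * p) * ?D - w * F w - w * z * p * (f 1 * w * (p - 1) / (1 - x)) = w\<^sup>2 * z * p * S x w p"
    by (simp add: sums_iff)
  moreover have "1 - x \<noteq> 0" using ne[of 1] by (simp add: x_def power2_eq_square)
  then have "f 1 * w * (p - 1) / (1 - x) * (1 - x) = f 1 * w * (p - 1)" by simp
  moreover have "w * z * p = w / p * x" using p by (simp add: x_def power2_eq_square)
  ultimately have "(1 - x) * (1 - z * p) * ?D =
      w * ((1 - x) * F w + w / p * x * (f 1 * (p - 1) + (1 - x) * S x w p))"
    by algebra
  then show ?thesis
    unfolding K_def x_def .
qed

end

section \<open>The root of the denominator\<close>

context power_series
begin

text \<open>At \<open>Q = 0\<close> the function is exactly \<open>1 - (1 + f 1) * x\<close>; each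
  deviation, from \<open>F Q - 1\<close>, from \<open>f 1 * Q\<close> and from \<open>S\<close>,
  carries a factor \<open>Q\<close>.\<close>

lemma K_linear_bound:
  assumes C: "0 \<le> C"
  obtains D where "0 \<le> D"
    "\<And>x Q. \<lbrakk>norm x \<le> C; norm Q \<le> r; C * norm Q \<le> 1/2\<rbrakk> \<Longrightarrow> norm (K x 1 Q Q - (1 - (1 + f 1) * x)) \<le> D * norm Q"
proof
  let ?D = "(1 + C) * (A / r) + C * (norm (f 1) + (1 + C) * (4 * A / r\<^sup>2))"
  show "0 \<le> ?D" using C A_nonneg r by (intro add_nonneg_nonneg mult_nonneg_nonneg) auto
  fix x Q :: complex assume x: "norm x \<le> C" and Q: "norm Q \<le> r" "C * norm Q \<le> 1/2"
  have "norm (x * Q) \<le> 1/2"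
    using mult_right_mono[OF x, of "norm Q"] Q by (simp add: norm_mult)
  then have S: "norm (S x Q Q) \<le> 4 * A / r\<^sup>2 * norm Q"
    using Q r by (intro S_bound) auto
  have x1: "norm (1 - x) \<le> 1 + C"
    using norm_triangle_ineq4[of 1 x] x by simp
  have "norm ((1 - x) * (F Q - 1)) \<le> (1 + C) * (A * norm Q / r)"
    unfolding norm_mult using F_bound[OF Q(1)] x1 by (intro mult_mono) (use C in auto)
  moreover have "norm (f 1 * Q) \<le> norm (f 1) * norm Q" by (simp add: norm_mult)
  moreover have "norm ((1 - x) * S x Q Q) \<le> (1 + C) * (4 * A / r\<^sup>2 * norm Q)"
    unfolding norm_mult using S x1 by (intro mult_mono) (use C in auto)
  then have "norm (f 1 * Q + (1 - x) * S x Q Q) \<le> norm (f 1) * norm Q + (1 + C) * (4 * A / r\<^sup>2 * norm Q)"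
    by (intro order_trans[OF norm_triangle_ineq] add_mono) (simp_all add: norm_mult)
  then have "norm (x * (f 1 * Q + (1 - x) * S x Q Q)) \<le> C * (norm (f 1) * norm Q + (1 + C) * (4 * A / r\<^sup>2 * norm Q))"
    unfolding norm_mult[of x] using x C by (intro mult_mono) auto
  ultimately have "norm ((1 - x) * (F Q - 1) + x * (f 1 * Q + (1 - x) * S x Q Q)) \<le>
      (1 + C) * (A * norm Q / r) + C * (norm (f 1) * norm Q + (1 + C) * (4 * A / r\<^sup>2 * norm Q))"
    by (intro order_trans[OF norm_triangle_ineq] add_mono)
  also have "\<dots> = ?D * norm Q" by (simp add: algebra_simps)
  also have "(1 - x) * (F Q - 1) + x * (f 1 * Q + (1 - x) * S x Q Q) = K x 1 Q Q - (1 - (1 + f 1) * x)"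
    by (simp add: K_def algebra_simps)
  finally show "norm (K x 1 Q Q - (1 - (1 + f 1) * x)) \<le> ?D * norm Q" .
qed

text \<open>Intended for \<open>u = q^(1-a)\<close> and \<open>v = q^(a-1)\<close>. Multiplication
  by \<open>v\<close> cancels the large factor \<open>u\<close>, and of the result only
  \<open>- f 1 * x\<close> survives when \<open>v\<close>, \<open>w\<close> and \<open>p\<close>
  tend to 0.\<close>

lemma K_dominant_bound:
  assumes C: "0 \<le> C"
  obtains D where "0 \<le> D"
    "\<And>x u v w p. \<lbrakk>norm x \<le> C; u * v = 1; norm w \<le> r; norm p \<le> 1; C * norm p \<le> 1/2\<rbrakk>
      \<Longrightarrow> norm (v * K x u w p + f 1 * x) \<le> D * (norm v + norm w + norm p)"
proof
  let ?a = "(1 + C) * (1 + A)" and ?b = "C * ((1 + C) * (4 * A / r\<^sup>2))" and ?c = "C * norm (f 1)"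
  have nonneg: "0 \<le> ?a" "0 \<le> ?b" "0 \<le> ?c"
    using C A_nonneg r by (intro mult_nonneg_nonneg; auto)+
  show "0 \<le> ?a + ?b + ?c" using nonneg by simp
  fix x u v w p :: complex
  assume x: "norm x \<le> C" and uv: "u * v = 1" and w: "norm w \<le> r" and p: "norm p \<le> 1" "C * norm p \<le> 1/2"
  have "norm (x * p) \<le> 1/2"
    using mult_right_mono[OF x, of "norm p"] p by (simp add: norm_mult)
  then have S: "norm (S x w p) \<le> 4 * A / r\<^sup>2 * norm w"
    using w p by (intro S_bound) auto
  have x1: "norm (1 - x) \<le> 1 + C"
    using norm_triangle_ineq4[of 1 x] x by simp
  have "A * norm w / r \<le> A * r / r"
    using w A_nonneg r by (intro divide_right_mono mult_left_mono) auto
  then have "norm (F w) \<le> 1 + A"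
    using F_bound[OF w] norm_triangle_ineq2[of "F w" 1] r by simp
  then have "norm ((1 - x) * F w) \<le> (1 + C) * (1 + A)"
    unfolding norm_mult using x1 C by (intro mult_mono) auto
  then have 1: "norm (v * ((1 - x) * F w)) \<le> ?a * norm v"
    unfolding norm_mult[of v] by (subst mult.commute) (rule mult_right_mono, auto)
  have "norm ((1 - x) * S x w p) \<le> (1 + C) * (4 * A / r\<^sup>2 * norm w)"
    unfolding norm_mult using S x1 C by (intro mult_mono) auto
  then have "norm (x * ((1 - x) * S x w p)) \<le> C * ((1 + C) * (4 * A / r\<^sup>2 * norm w))"
    unfolding norm_mult[of x] using x C by (intro mult_mono) auto
  then have 2: "norm (x * ((1 - x) * S x w p)) \<le> ?b * norm w" by (simp add: mult_ac)
  have 3: "norm (x * (f 1 * p)) \<le> ?c * norm p"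
    unfolding norm_mult mult.assoc[symmetric] using x by (intro mult_right_mono) auto
  have "v * K x u w p + f 1 * x = v * ((1 - x) * F w) + x * ((1 - x) * S x w p) + x * (f 1 * p)"
    unfolding K_def using uv by algebra
  also have "norm \<dots> \<le> ?a * norm v + ?b * norm w + ?c * norm p"
    by (intro norm_triangle_mono 1 2 3)
  also have "\<dots> \<le> (?a + ?b + ?c) * norm v + (?a + ?b + ?c) * norm w + (?a + ?b + ?c) * norm p"
    by (intro add_mono mult_right_mono) (use nonneg in auto)
  also have "\<dots> = (?a + ?b + ?c) * (norm v + norm w + norm p)" by (simp only: distrib_left)
  finally show "norm (v * K x u w p + f 1 * x) \<le> (?a + ?b + ?c) * (norm v + norm w + norm p)" .
qed

text \<open>With \<open>b = 1 + f 1\<close>, the equation reads \<open>x = 1 / b + R x Q\<close>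
  with a small \<open>R\<close>. Two roots would differ by at most half their difference, hence
  uniqueness on the closed disc; the derivative is \<open>- b + b * R'\<close> with
  \<open>norm R' <= 1/2\<close>, hence a simple zero.\<close>

lemma K_root:
  assumes f1: "f 1 \<noteq> -1" and c: "1 / norm (1 + f 1) < c"
  obtains \<delta> X where "0 < \<delta>" "\<delta> \<le> r" "(c + 2) * \<delta> \<le> 1/2" "X holomorphic_on ball 0 \<delta>" "X 0 = 1 / (1 + f 1)"
    "\<And>Q. norm Q < \<delta> \<Longrightarrow> norm (X Q) < c"
    "\<And>Q x. \<lbrakk>norm Q < \<delta>; norm x \<le> c\<rbrakk> \<Longrightarrow> K x 1 Q Q = 0 \<longleftrightarrow> x = X Q"
    "\<And>Q x. \<lbrakk>norm Q < \<delta>; norm x \<le> c\<rbrakk> \<Longrightarrow>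
      norm (deriv (\<lambda>x. K x 1 Q Q) x + (1 + f 1)) \<le> norm (1 + f 1) / 2"
proof -
  define b where "b = 1 + f 1"
  have b: "b \<noteq> 0" using f1 by (simp add: b_def add_eq_0_iff)
  then have nb: "norm b > 0" by simp
  with c have c0: "0 < c" by (auto simp: b_def intro: order.strict_trans[of 0 "1 / norm (1 + f 1)"])
  obtain D where D: "0 \<le> D" "\<And>x Q. \<lbrakk>norm x \<le> c + 2; norm Q \<le> r; (c + 2) * norm Q \<le> 1/2\<rbrakk>
      \<Longrightarrow> norm (K x 1 Q Q - (1 - (1 + f 1) * x)) \<le> D * norm Q"
    using K_linear_bound[of "c + 2"] c0 by auto
  define R where "R = (\<lambda>x Q. (K x 1 Q Q - (1 - b * x)) / b)"
  \<comment> \<open>Half the gap between the limiting root \<open>1 / b\<close> and the circle of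
    radius \<open>c\<close>, so that the root stays strictly inside.\<close>
  define \<eta> where "\<eta> = (c - 1 / norm b) / 2"
  have \<eta>: "0 < \<eta>" using c by (simp add: \<eta>_def b_def)
  \<comment> \<open>\<open>1/2\<close> makes \<open>R\<close> a contraction, \<open>\<eta>\<close>
    makes the iteration stay in the disc.\<close>
  define \<epsilon> where "\<epsilon> = min (1/2) \<eta>"
  have \<epsilon>: "0 < \<epsilon>" using \<eta> by (simp add: \<epsilon>_def)
  \<comment> \<open>The second entry yields \<open>(c + 2) * norm Q <= 1/2\<close>, the third
    \<open>D * norm Q / norm b <= \<epsilon>\<close>.\<close>
  define \<delta> where "\<delta> = min r (min (1 / (2 * (c + 2))) (\<epsilon> * norm b / (D + 1)))"
  have \<delta>: "0 < \<delta>" "\<delta> \<le> r" using r c0 D(1) nb \<epsilon> by (simp_all add: \<delta>_def)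
  have \<delta>c: "(c + 2) * \<delta> \<le> 1/2"
  proof -
    have "(c + 2) * \<delta> \<le> (c + 2) * (1 / (2 * (c + 2)))"
      using c0 by (intro mult_left_mono) (auto simp: \<delta>_def)
    also have "\<dots> = 1/2" using c0 by (simp add: field_simps)
    finally show ?thesis .
  qed
  have cQ: "(c + 2) * norm Q \<le> 1/2" if "norm Q < \<delta>" for Q :: complex
    using mult_left_mono[of "norm Q" \<delta> "c + 2"] that c0 \<delta>c by linarith
  have Rb: "norm (R x Q) \<le> D * norm Q / norm b" if "norm Q < \<delta>" "norm x \<le> c + 2" for x Q
    unfolding R_def norm_divide using D(2)[OF that(2) _ cQ[OF that(1)]] that \<delta> nb
    by (intro divide_right_mono) (auto simp: b_def)
  have R\<epsilon>: "norm (R x Q) \<le> \<epsilon>" if "norm Q < \<delta>" "norm x \<le> c + 2" for x Q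
  proof -
    have "(D + 1) * norm Q \<le> (D + 1) * (\<epsilon> * norm b / (D + 1))"
      using that D(1) by (intro mult_left_mono) (auto simp: \<delta>_def)
    then have "(D + 1) * norm Q \<le> \<epsilon> * norm b" using D(1) by simp
    then have "D * norm Q \<le> \<epsilon> * norm b" using norm_ge_zero[of Q] unfolding distrib_right mult_1_left by linarith
    then have "D * norm Q / norm b \<le> \<epsilon>" using nb by (simp add: divide_le_eq)
    with Rb[OF that] show ?thesis by simp
  qed
  have xp: "norm (x * Q) \<le> 1/2" if "norm Q < \<delta>" "norm x \<le> c + 2" for x Q :: complex
    using mult_right_mono[OF that(2), of "norm Q"] cQ[OF that(1)] by (simp add: norm_mult)
  have Rx: "(\<lambda>x. R x Q) holomorphic_on ball 0 (c + 2)" if "norm Q < \<delta>" for Q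
  proof -
    have "(\<lambda>x. K x 1 Q Q) holomorphic_on ball 0 (c + 2)"
      using that xp[OF that] \<delta> r by (intro K_holomorphic) (auto intro!: holomorphic_intros)
    then show ?thesis unfolding R_def by (intro holomorphic_intros b)
  qed
  have lip: "norm (R x Q - R y Q) \<le> norm (x - y) / 2"
    if "norm Q < \<delta>" "norm x \<le> c" "norm y \<le> c" for x y Q
  proof -
    have "norm (R x Q - R y Q) \<le> \<epsilon> * norm (x - y)"
      using R\<epsilon>[OF that(1)] by (intro bounded_holomorphic_lipschitz[OF Rx[OF that(1)]] that) auto
    also have "\<dots> \<le> 1/2 * norm (x - y)" by (intro mult_right_mono) (auto simp: \<epsilon>_def)
    finally show ?thesis by simp
  qed
  have bd: "norm (R x Q) \<le> \<eta>" if "norm Q < \<delta>" "norm x \<le> c" for x Q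
    using R\<epsilon>[OF that(1), of x] that by (simp add: \<epsilon>_def)
  have holo: "(\<lambda>Q. R (Y Q) Q) holomorphic_on ball 0 \<delta>"
    if Y: "Y holomorphic_on ball 0 \<delta>" "\<And>Q. norm Q < \<delta> \<Longrightarrow> norm (Y Q) \<le> c" for Y
  proof -
    have "(\<lambda>Q. K (Y Q) 1 Q Q) holomorphic_on ball 0 \<delta>"
    proof (rule K_holomorphic)
      fix Q assume "Q \<in> ball (0::complex) \<delta>"
      with xp[of Q "Y Q"] Y(2)[of Q] \<delta> r show "norm Q < r \<and> norm Q \<le> 1 \<and> norm (Y Q * Q) \<le> 1/2"
        by auto
    qed (auto intro!: holomorphic_intros Y)
    then show ?thesis unfolding R_def by (intro holomorphic_intros b Y)
  qed
  have \<eta>c: "norm (1 / b) + \<eta> < c"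
    using c unfolding \<eta>_def b_def[symmetric] by (simp add: norm_divide field_simps)
  obtain X where X: "X holomorphic_on ball 0 \<delta>" "\<And>Q. norm Q < \<delta> \<Longrightarrow> norm (X Q) \<le> c"
      "\<And>Q. norm Q < \<delta> \<Longrightarrow> X Q = 1 / b + R (X Q) Q"
  proof (rule holomorphic_fixed_point[of \<delta> c R \<eta> "1 / b"])
    show "norm (R x Q - R y Q) \<le> norm (x - y) / 2" if "norm Q < \<delta>" "norm x \<le> c" "norm y \<le> c" for Q x y
      using that by (rule lip)
    show "norm (R x Q) \<le> \<eta>" if "norm Q < \<delta>" "norm x \<le> c" for Q x
      using that by (rule bd)
    show "(\<lambda>Q. R (Y Q) Q) holomorphic_on ball 0 \<delta>"
      if "Y holomorphic_on ball 0 \<delta>" "\<And>Q. norm Q < \<delta> \<Longrightarrow> norm (Y Q) \<le> c" for Y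
      using that by (rule holo)
  qed (rule less_imp_le[OF \<eta>c] less_imp_le[OF \<eta>] that; assumption?)+
  have K_iff: "K x 1 Q Q = 0 \<longleftrightarrow> x = 1 / b + R x Q" for x Q
    using b by (simp add: R_def field_simps)
  show ?thesis
  proof (rule that[OF \<delta> \<delta>c X(1)])
    have "R (X 0) 0 = 0" using Rb[of 0 "X 0"] X(2)[of 0] \<delta> by simp
    then show "X 0 = 1 / (1 + f 1)" using X(3)[of 0] \<delta> by (simp add: b_def)
  next
    fix Q :: complex assume Q: "norm Q < \<delta>"
    show "norm (X Q) < c"
      using norm_triangle_ineq[of "1 / b" "R (X Q) Q"] X(3)[OF Q] bd[OF Q X(2)[OF Q]] \<eta>c
      by simp
    fix x :: complex assume x: "norm x \<le> c"
    show "K x 1 Q Q = 0 \<longleftrightarrow> x = X Q"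
    proof
      assume "K x 1 Q Q = 0"
      then have "x - X Q = R x Q - R (X Q) Q"
        using X(3)[OF Q] unfolding K_iff by (metis add_diff_cancel_left)
      with lip[OF Q x X(2)[OF Q]] show "x = X Q" by simp
    qed (use X(3)[OF Q] K_iff in blast)
    have hd: "(\<lambda>x. R x Q) field_differentiable at x"
      using Rx[OF Q] x by (intro holomorphic_on_imp_differentiable_at) auto
    have "norm (deriv (\<lambda>x. R x Q) x) \<le> \<epsilon>"
      by (rule bounded_holomorphic_deriv[OF Rx[OF Q] _ x]) (use R\<epsilon>[OF Q] in auto)
    then have "norm (deriv (\<lambda>x. R x Q) x) \<le> 1/2" by (simp add: \<epsilon>_def)
    have "(\<lambda>x. K x 1 Q Q) = (\<lambda>x. 1 - b * x + b * R x Q)"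
      using b by (simp add: R_def)
    moreover have "((\<lambda>x. 1 - b * x + b * R x Q) has_field_derivative - b + b * deriv (\<lambda>x. R x Q) x) (at x)"
      using hd[THEN field_differentiable_derivI] by (auto intro!: derivative_eq_intros)
    ultimately have "deriv (\<lambda>x. K x 1 Q Q) x = - b + b * deriv (\<lambda>x. R x Q) x"
      by (simp only: DERIV_imp_deriv)
    then have "deriv (\<lambda>x. K x 1 Q Q) x + (1 + f 1) = b * deriv (\<lambda>x. R x Q) x"
      unfolding b_def[symmetric] by simp
    with \<open>norm (deriv (\<lambda>x. R x Q) x) \<le> 1/2\<close> show "norm (deriv (\<lambda>x. K x 1 Q Q) x + (1 + f 1)) \<le> norm (1 + f 1) / 2"
      using mult_left_mono[of "norm (deriv (\<lambda>x. R x Q) x)" "1/2" "norm b"]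
      unfolding b_def[symmetric] by (simp add: norm_mult)
  qed
qed

text \<open>Taylor expansion respects the field operations involved, so the identity near 0 carries
  over to power series. Only the infinite sum needs an argument: its partial sums converge uniformly
  and X-adically.\<close>

lemma K_root_formal:
  assumes \<delta>: "0 < \<delta>" "\<delta> \<le> r" and X: "X holomorphic_on ball 0 \<delta>"
    and b: "\<And>Q. norm Q < \<delta> \<Longrightarrow> norm (X Q * Q) \<le> 1/2"
    and root: "\<And>Q. norm Q < \<delta> \<Longrightarrow> K (X Q) 1 Q Q = 0"
  shows "M_ser f (fps_expansion X 0) = 0"
proof -
  let ?X = "fps_expansion X 0"
  have X_exp: "X has_fps_expansion ?X"
    using X \<delta> by (intro has_fps_expansion_fps_expansion[of "ball 0 \<delta>"]) auto
  have b': "norm Q \<le> r \<and> norm Q \<le> 1 \<and> norm (X Q * Q) \<le> 1/2" if "Q \<in> ball 0 \<delta>" for Q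
    using b[of Q] that \<delta> r by auto
  let ?t = "\<lambda>i Q. if i < 2 then 0 else f i * (Q ^ (i - 1) * (Q ^ i - 1)) / (1 - X Q * Q ^ (i - 1))"
  have t_exp: "(\<lambda>Q. ?t i Q) has_fps_expansion S_term f ?X i" for i
  proof (cases "i < 2")
    case False
    have "(\<lambda>Q. f i * (Q ^ (i - 1) * (Q ^ i - 1)) * inverse (1 - X Q * Q ^ (i - 1))) has_fps_expansion
        fps_const (f i) * (fps_X ^ (i - 1) * (fps_X ^ i - 1)) * inverse (1 - ?X * fps_X ^ (i - 1))"
      using False by (intro fps_expansion_intros X_exp) auto
    with False show ?thesis by (simp add: S_term_def divide_inverse)
  qed (simp add: S_term_def)
  have t_holo: "(\<lambda>Q. ?t i Q) holomorphic_on ball 0 \<delta>" for i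
  proof (cases "i < 2")
    case False
    have "1 - X Q * Q ^ (i - 1) \<noteq> 0" if "Q \<in> ball 0 \<delta>" for Q
      using S_denominator_bound[of "X Q" Q i] b'[OF that] False by auto
    with False show ?thesis by (auto intro!: holomorphic_intros X)
  qed auto
  let ?S = "\<lambda>Q. S (X Q) Q Q"
  have lim: "uniform_limit (ball 0 \<delta>) (\<lambda>n Q. \<Sum>i<n. ?t i Q) ?S sequentially"
    by (rule S_uniform_limit) (use b' in auto)
  have "?S holomorphic_on ball 0 \<delta>"
    by (intro S_holomorphic X holomorphic_intros b') auto
  then have "?S has_fps_expansion fps_expansion ?S 0"
    using \<delta> by (intro has_fps_expansion_fps_expansion[of "ball 0 \<delta>"]) auto
  moreover have "fps_expansion ?S 0 = (\<Sum>n. S_term f ?X n)"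
  proof (rule uniform_limit_imp_fps_expansion_eq[OF _ lim])
    show "(\<lambda>n. \<Sum>i<n. S_term f ?X i) \<longlonglongrightarrow> (\<Sum>n. S_term f ?X n)"
      using S_term_sums(1) unfolding sums_def .
    show "\<forall>\<^sub>F n in sequentially. (\<lambda>Q. \<Sum>i<n. ?t i Q) has_fps_expansion (\<Sum>i<n. S_term f ?X i)"
      by (intro always_eventually allI has_fps_expansion_sum t_exp)
    show "\<forall>\<^sub>F n in sequentially. (\<lambda>Q. \<Sum>i<n. ?t i Q) holomorphic_on ball 0 \<delta>"
      by (intro always_eventually allI holomorphic_on_sum t_holo)
  qed (use calculation \<delta> in simp_all)
  ultimately have S_exp: "?S has_fps_expansion (\<Sum>n. S_term f ?X n)" by simp
  have "(\<lambda>Q. (1 - X Q) * F Q + f 1 * X Q * (Q - 1) + X Q * (1 - X Q) * ?S Q) has_fps_expansion M_ser f ?X"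
    unfolding M_ser_def by (intro fps_expansion_intros X_exp F_has_fps_expansion S_exp)
  moreover have "\<forall>\<^sub>F Q in nhds 0. (1 - X Q) * F Q + f 1 * X Q * (Q - 1) + X Q * (1 - X Q) * ?S Q = 0"
  proof -
    have "\<forall>\<^sub>F Q in nhds 0. Q \<in> ball (0::complex) \<delta>"
      using \<delta> by (intro eventually_nhds_in_open) auto
    then show ?thesis
    proof eventually_elim
      case (elim Q)
      then show ?case using root[of Q] by (simp add: K_def algebra_simps)
    qed
  qed
  ultimately have "(\<lambda>Q. 0) has_fps_expansion M_ser f ?X"
    by (subst (asm) has_fps_expansion_cong[OF _ refl])
  then show ?thesis
    by (rule fps_expansion_unique_complex) (rule has_fps_expansion_0)
qed

end

section \<open>Simple poles and averages over roots of unity\<close>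

text \<open>The identity theorem in the form suited to functions fixed only up to isolated points: a
  meromorphic difference vanishes almost everywhere or almost nowhere.\<close>

lemma meromorphic_identity:
  assumes "f meromorphic_on UNIV" "g meromorphic_on UNIV" and eq: "\<forall>\<^sub>F w in at a. f w = g w"
  shows "\<forall>\<^sub>F w in at b. f w = g w"
proof -
  have "(\<lambda>w. f w - g w) meromorphic_on UNIV"
    using assms by (intro meromorphic_intros)
  then have "(\<forall>\<^sub>F w in cosparse UNIV. f w - g w = 0) \<or> (\<forall>\<^sub>F w in cosparse UNIV. f w - g w \<noteq> 0)"
    by (rule meromorphic_imp_constant_or_avoid) auto
  moreover have "\<not> (\<forall>\<^sub>F w in cosparse UNIV. f w - g w \<noteq> 0)"
  proof
    assume "\<forall>\<^sub>F w in cosparse UNIV. f w - g w \<noteq> 0"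
    then have "\<forall>\<^sub>F w in at a. f w - g w \<noteq> 0"
      by (simp add: eventually_cosparse_open_eq)
    with eq have "\<forall>\<^sub>F w in at a. False"
      by eventually_elim auto
    then show False by simp
  qed
  ultimately have "\<forall>\<^sub>F w in cosparse UNIV. f w - g w = 0" by blast
  then show ?thesis by (simp add: eventually_cosparse_open_eq)
qed

text \<open>The divided difference \<open>V1\<close> of \<open>V\<close> at \<open>a\<close> is
  holomorphic, takes the value \<open>deriv V a\<close> at \<open>a\<close> and has no zeros;
  \<open>U / V1\<close> is the required function.\<close>

lemma quotient_simple_zero_factor:
  assumes V: "V holomorphic_on ball 0 R" and U: "U holomorphic_on ball 0 R" and a: "norm a < R"
    and zero: "V a = 0" "deriv V a \<noteq> 0" "\<And>z. \<lbrakk>norm z < R; V z = 0\<rbrakk> \<Longrightarrow> z = a"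
  shows "\<exists>\<phi>. \<phi> holomorphic_on ball 0 R \<and> \<phi> a = U a / deriv V a \<and>
    (\<forall>z. norm z < R \<and> z \<noteq> a \<longrightarrow> U z / V z = \<phi> z / (z - a))"
proof -
  define V1 where "V1 = (\<lambda>z. if z = a then deriv V a else (V z - V a) / (z - a))"
  have "V1 holomorphic_on ball 0 R"
    unfolding V1_def by (rule pole_lemma_open[OF V open_ball])
  moreover have "V1 z \<noteq> 0" if "z \<in> ball 0 R" for z
  proof (cases "z = a")
    case False
    then have "V z \<noteq> 0" using zero(3)[of z] that by auto
    with False zero(1) show ?thesis by (simp add: V1_def)
  qed (simp add: V1_def zero(2))
  ultimately have "(\<lambda>z. U z / V1 z) holomorphic_on ball 0 R"
    using U by (intro holomorphic_on_divide)
  then show ?thesis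
    by (intro exI[of _ "\<lambda>z. U z / V1 z"]) (simp add: V1_def zero(1))
qed

text \<open>Holomorphy on a strictly larger disc rules out further poles on the boundary circle
  too.\<close>

lemma quotient_simple_pole:
  assumes V: "V holomorphic_on ball 0 R'" and U: "U holomorphic_on ball 0 R'" and a: "norm a < R" "R < R'"
    and zero: "V a = 0" "deriv V a \<noteq> 0" "\<And>z. \<lbrakk>norm z \<le> R; V z = 0\<rbrakk> \<Longrightarrow> z = a" and Ua: "U a \<noteq> 0"
    and G: "\<And>z. \<forall>\<^sub>F w in at z. G w = U w / V w"
  shows "{z. norm z \<le> R \<and> is_pole G z} = {a}" "zorder G a = -1" "residue G a = U a / deriv V a"
proof -
  have sub: "ball 0 R \<subseteq> ball (0::complex) R'" using a by (intro subset_ball) auto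
  have zero': "z = a" if "norm z < R" "V z = 0" for z
    by (rule zero(3)) (use that in auto)
  obtain \<phi> where \<phi>: "\<phi> holomorphic_on ball 0 R" "\<phi> a = U a / deriv V a"
    "\<And>z. \<lbrakk>norm z < R; z \<noteq> a\<rbrakk> \<Longrightarrow> U z / V z = \<phi> z / (z - a)"
    using quotient_simple_zero_factor[OF holomorphic_on_subset[OF V sub] holomorphic_on_subset[OF U sub]
      a(1) zero(1,2) zero'] by blast
  have \<phi>a: "\<phi> a \<noteq> 0" using \<phi>(2) zero(2) Ua by simp
  obtain A where A: "open A" "a \<in> A" "\<And>w. \<lbrakk>w \<in> A; w \<noteq> a\<rbrakk> \<Longrightarrow> G w = U w / V w"
    using G[of a] unfolding eventually_at_topological by auto
  define B where "B = A \<inter> ball 0 R"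
  have B: "open B" "a \<in> B" "\<phi> holomorphic_on B"
    using A a \<phi>(1) by (auto simp: B_def intro: holomorphic_on_subset)
  have GB: "G w = \<phi> w / (w - a)" if "w \<in> B" "w \<noteq> a" for w
    using that A(3)[of w] \<phi>(3)[of w] by (simp add: B_def)
  have ev: "\<forall>\<^sub>F w in at a. G w = \<phi> w / (w - a)"
    unfolding eventually_at_topological using B GB by blast
  have "is_pole (\<lambda>w. \<phi> w / (w - a) ^ 1) a"
    using B \<phi>a by (intro is_pole_basic[of _ B]) auto
  then have "is_pole G a"
    using is_pole_cong[OF ev refl] by simp
  moreover have "z = a" if z: "norm z \<le> R" "is_pole G z" for z
  proof (rule ccontr)
    assume "z \<noteq> a"
    then have "V z \<noteq> 0" using zero z by blast
    have "z \<in> ball 0 R'" using z(1) a by simp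
    then have "U analytic_on {z}" "V analytic_on {z}"
      using U V analytic_at open_ball by blast+
    then have "(\<lambda>w. U w / V w) analytic_on {z}"
      using \<open>V z \<noteq> 0\<close> by (intro analytic_intros) auto
    then have "\<not> is_pole (\<lambda>w. U w / V w) z"
      by (rule analytic_at_imp_no_pole)
    with z is_pole_cong[OF G refl] show False by blast
  qed
  ultimately show "{z. norm z \<le> R \<and> is_pole G z} = {a}" using a by auto
  show "zorder G a = -1"
    using B \<phi>a by (rule zorder_eqI) (simp add: GB power_int_minus field_simps)
  have "residue G a = residue (\<lambda>w. \<phi> w / (w - a)) a"
    by (rule residue_cong[OF ev refl])
  also have "\<dots> = \<phi> a" using B by (rule residue_simple)
  finally show "residue G a = U a / deriv V a" by (simp add: \<phi>(2))
qed

text \<open>The remainder \<open>H\<close> is the divided difference at \<open>a\<close> of the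
  numerator left after cancelling the zero.\<close>

lemma quotient_principal_part:
  assumes V: "V holomorphic_on ball 0 R" and U: "U holomorphic_on ball 0 R" and a: "norm a < R"
    and zero: "V a = 0" "deriv V a \<noteq> 0" "\<And>z. \<lbrakk>norm z < R; V z = 0\<rbrakk> \<Longrightarrow> z = a"
  obtains H where "H holomorphic_on ball 0 R"
    "\<And>z. \<lbrakk>norm z < R; z \<noteq> a\<rbrakk> \<Longrightarrow> U z / V z = U a / deriv V a / (z - a) + H z"
proof -
  obtain \<phi> where \<phi>: "\<phi> holomorphic_on ball 0 R" "\<phi> a = U a / deriv V a"
    "\<And>z. \<lbrakk>norm z < R; z \<noteq> a\<rbrakk> \<Longrightarrow> U z / V z = \<phi> z / (z - a)"
    using quotient_simple_zero_factor[OF V U a zero] by blast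
  have "(\<lambda>z. if z = a then deriv \<phi> a else (\<phi> z - \<phi> a) / (z - a)) holomorphic_on ball 0 R"
    by (rule pole_lemma_open[OF \<phi>(1) open_ball])
  then show ?thesis
    by (rule that) (simp add: \<phi>(3) diff_divide_distrib flip: \<phi>(2))
qed

text \<open>Multiplication by a primitive root \<open>\<zeta>\<close> permutes the roots of unity,
  so the sum is fixed under multiplication by \<open>\<zeta> ^ n\<close>, which differs from 1
  unless \<open>d\<close> divides \<open>n\<close>.\<close>

lemma sum_roots_of_unity_power:
  assumes d: "d > 0"
  shows "(\<Sum>z | z ^ d = 1. z ^ n) = (if d dvd n then of_nat d else (0::complex))"
proof (cases "d dvd n")
  case True
  then obtain m where "n = d * m" by auto
  then have "(\<Sum>z::complex | z ^ d = 1. z ^ n) = (\<Sum>z::complex | z ^ d = 1. 1)"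
    by (intro sum.cong) (auto simp: power_mult)
  with True d show ?thesis by (simp add: card_roots_unity_eq)
next
  case False
  define \<zeta> where "\<zeta> = exp (2 * of_real pi * \<i> * of_nat 1 / of_nat d)"
  have \<zeta>d: "\<zeta> ^ d = 1" using complex_root_unity[of d 1] d by (simp add: \<zeta>_def)
  have "\<zeta> ^ n = exp (2 * of_real pi * \<i> * of_nat n / of_nat d)"
    unfolding \<zeta>_def by (simp flip: exp_of_nat_mult add: mult_ac)
  with False d have \<zeta>n: "\<zeta> ^ n \<noteq> 1"
    using complex_root_unity_eq_1[of d n] by simp
  have "\<zeta> \<noteq> 0" by (simp add: \<zeta>_def)
  have "(\<Sum>z | z ^ d = 1. z ^ n) = (\<Sum>z | z ^ d = 1. (\<zeta> * z) ^ n)"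
    by (rule sum.reindex_bij_witness[of _ "\<lambda>z. \<zeta> * z" "\<lambda>z. z / \<zeta>"])
      (use \<zeta>d \<open>\<zeta> \<noteq> 0\<close> in \<open>auto simp: power_mult_distrib power_divide\<close>)
  also have "\<dots> = \<zeta> ^ n * (\<Sum>z | z ^ d = 1. z ^ n)"
    by (simp add: power_mult_distrib sum_distrib_left)
  finally have "(\<zeta> ^ n - 1) * (\<Sum>z | z ^ d = 1. z ^ n) = 0"
    by (simp add: algebra_simps)
  with \<zeta>n False show ?thesis by simp
qed

lemma roots_of_unity_average:
  fixes c :: "nat \<Rightarrow> complex"
  assumes d: "d > 0" and g: "\<And>z. norm z = 1 \<Longrightarrow> (\<lambda>n. c n * z ^ n) sums g z"
  shows "(\<lambda>l. c (d * l)) sums ((\<Sum>z | z ^ d = 1. g z) / of_nat d)"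
proof -
  have "norm z = 1" if "z ^ d = 1" for z :: complex
    using that d power_eq_1_iff by blast
  then have "(\<lambda>n. \<Sum>z | z ^ d = 1. c n * z ^ n) sums (\<Sum>z | z ^ d = 1. g z)"
    by (intro sums_sum g) auto
  also have "(\<lambda>n. \<Sum>z | z ^ d = 1. c n * z ^ n) = (\<lambda>n. c n * (if d dvd n then of_nat d else 0))"
    by (simp add: sum_distrib_left[symmetric] sum_roots_of_unity_power[OF d])
  finally have "(\<lambda>n. c n * (if d dvd n then of_nat d else 0)) sums (\<Sum>z | z ^ d = 1. g z)" .
  then have "(\<lambda>l. c (d * l) * (if d dvd d * l then of_nat d else 0)) sums (\<Sum>z | z ^ d = 1. g z)"
    by (subst sums_mono_reindex) (use d in \<open>auto simp: strict_mono_def\<close>)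
  then have "(\<lambda>l. c (d * l) * of_nat d / of_nat d) sums ((\<Sum>z | z ^ d = 1. g z) / of_nat d)"
    by (intro sums_divide) simp
  with d show ?thesis by simp
qed

text \<open>The summand \<open>- 1 / a\<close> is the coefficient of index 0 and will be absorbed by
  \<open>T\<close>; the other one becomes the main term.\<close>

lemma roots_of_unity_average_pole:
  fixes a :: complex
  assumes d: "d > 0" and a: "norm a > 1"
  shows "(\<Sum>z | z ^ d = 1. 1 / (z - a)) / of_nat d = - 1 / a - 1 / a * (a powi (- int d) / (1 - a powi (- int d)))"
proof -
  have a0: "a \<noteq> 0" using a by auto
  have "(\<lambda>l. - 1 / a * (1 / a) ^ (d * l)) sums ((\<Sum>z | z ^ d = 1. 1 / (z - a)) / of_nat d)"
  proof (rule roots_of_unity_average[OF d])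
    fix z :: complex assume z: "norm z = 1"
    then have "norm (z / a) < 1" using a by (simp add: norm_divide divide_less_eq)
    then have "(\<lambda>n. - 1 / a * (z / a) ^ n) sums (- 1 / a * (1 / (1 - z / a)))"
      by (intro sums_mult geometric_sums)
    also have "1 - z / a = - ((z - a) / a)" using a0 by (simp add: diff_divide_distrib)
    also have "- 1 / a * (1 / - ((z - a) / a)) = 1 / (z - a)" using a0 by simp
    finally show "(\<lambda>n. - 1 / a * (1 / a) ^ n * z ^ n) sums (1 / (z - a))"
      by (simp add: power_divide)
  qed
  then have s1: "(\<lambda>l. - 1 / a * ((1 / a) ^ d) ^ l) sums ((\<Sum>z | z ^ d = 1. 1 / (z - a)) / of_nat d)"
    by (simp only: power_mult)
  have "norm (1 / a) < 1" using a by (simp add: norm_divide divide_less_eq)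
  then have ny: "norm ((1 / a) ^ d) < 1"
    using power_strict_decreasing[of 0 d "norm (1 / a)"] d a0 by (simp add: norm_power)
  then have s2: "(\<lambda>l. - 1 / a * ((1 / a) ^ d) ^ l) sums (- 1 / a * (1 / (1 - (1 / a) ^ d)))"
    by (intro sums_mult geometric_sums)
  have "1 / (1 - y) = 1 + y / (1 - y)" if "1 - y \<noteq> 0" for y :: complex
    using that by (simp add: divide_simps)
  moreover have "1 - (1 / a) ^ d \<noteq> 0" using ny by auto
  ultimately have "1 / (1 - (1 / a) ^ d) = 1 + (1 / a) ^ d / (1 - (1 / a) ^ d)" .
  with sums_unique2[OF s1 s2]
  have "(\<Sum>z | z ^ d = 1. 1 / (z - a)) / of_nat d = - 1 / a * (1 + (1 / a) ^ d / (1 - (1 / a) ^ d))"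
    by simp
  moreover have "a powi (- int d) = (1 / a) ^ d"
    by (simp add: power_int_minus power_one_over inverse_eq_divide)
  ultimately show ?thesis by (simp only: distrib_left mult_1_right) simp
qed

text \<open>Convergence of the Taylor series at the point \<open>r0\<close> bounds its terms, hence
  the coefficients by \<open>B / r0^n\<close>. The positive multiples of \<open>d\<close> form a
  geometric tail of ratio at most \<open>1 / r0 < 1\<close>, so the constant does not depend on
  \<open>d\<close>.\<close>

lemma roots_of_unity_average_bound:
  assumes H: "H holomorphic_on ball 0 R" and r0: "1 < r0" "r0 < R"
  obtains B where "\<And>d. d > 0 \<Longrightarrow> norm ((\<Sum>z | z ^ d = 1. H z) / of_nat d - H 0) \<le> B * r0 powi (- int d)"
proof -
  define h where "h = (\<lambda>n. (deriv ^^ n) H 0 / fact n)"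
  have h_sums: "(\<lambda>n. h n * z ^ n) sums H z" if "norm z < R" for z
    using holomorphic_power_series[OF H, of z] that by (simp add: h_def)
  have "summable (\<lambda>n. h n * of_real r0 ^ n)"
    by (rule sums_summable[OF h_sums]) (use r0 in simp)
  then have "bounded (range (\<lambda>n. h n * of_real r0 ^ n))"
    by (rule convergent_imp_bounded[OF summable_LIMSEQ_zero])
  then obtain B where B: "\<And>n. norm (h n * of_real r0 ^ n) \<le> B"
    unfolding bounded_iff by blast
  have hB: "norm (h n) \<le> B * (1 / r0) ^ n" for n
    using B[of n] r0 by (simp add: norm_mult norm_power power_one_over field_simps)
  have B0: "0 \<le> B" using B[of 0] norm_ge_zero order_trans by blast
  show ?thesis
  proof (rule that)
    fix d :: nat assume d: "d > 0"
    define s where "s = (1 / r0) ^ d"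
    have s: "0 \<le> s" "s \<le> 1 / r0" "s < 1"
      using r0 d power_decreasing[of 1 d "1 / r0"] by (auto simp: s_def power_one_over)
    have "(\<lambda>l. h (d * l)) sums ((\<Sum>z | z ^ d = 1. H z) / of_nat d)"
      by (rule roots_of_unity_average[OF d h_sums]) (use r0 in auto)
    then have "(\<lambda>l. h (d * Suc l)) sums ((\<Sum>z | z ^ d = 1. H z) / of_nat d - h (d * 0))"
      by (subst sums_Suc_iff) simp
    then have e: "(\<Sum>z | z ^ d = 1. H z) / of_nat d - H 0 = (\<Sum>l. h (d * Suc l))"
      by (simp add: sums_iff h_def)
    have "norm (h (d * Suc l)) \<le> B * s * s ^ l" for l
      using hB[of "d * Suc l"] unfolding power_mult s_def by (simp add: mult_ac)
    moreover have "summable (\<lambda>l. B * s * s ^ l)"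
      using s by (intro summable_mult summable_geometric) auto
    ultimately have "norm (\<Sum>l. h (d * Suc l)) \<le> (\<Sum>l. B * s * s ^ l)"
      by (rule norm_suminf_le)
    also have "\<dots> = B * s * (1 / (1 - s))"
      using s by (subst suminf_mult) (auto simp: suminf_geometric)
    also have "\<dots> \<le> B * s * (1 / (1 - 1 / r0))"
      using s r0 B0 by (intro mult_left_mono divide_left_mono mult_pos_pos) auto
    also have "s = r0 powi (- int d)"
      by (simp add: s_def power_int_minus power_one_over inverse_eq_divide)
    finally show "norm ((\<Sum>z | z ^ d = 1. H z) / of_nat d - H 0) \<le> B * (1 / (1 - 1 / r0)) * r0 powi (- int d)"
      unfolding e by (simp add: mult_ac)
  qed
qed

section \<open>The meromorphic continuation for small parameters\<close>

lemma Reals_suminf: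
  fixes g :: "nat \<Rightarrow> complex"
  assumes "summable g" "\<And>n. g n \<in> \<real>"
  shows "suminf g \<in> \<real>"
  using closed_sequentially[OF closed_complex_Reals _ summable_LIMSEQ[OF assms(1)]] assms(2)
  by (simp add: sum_in_Reals)

text \<open>Difference quotients along real increments are real, and so is their limit. Serves the
  sign of the main term.\<close>

lemma Reals_deriv:
  fixes h :: "complex \<Rightarrow> complex"
  assumes h: "h field_differentiable at x" and x: "x \<in> \<real>" and e: "e > 0"
    and real: "\<And>y. \<lbrakk>y \<in> \<real>; norm (y - x) < e\<rbrakk> \<Longrightarrow> h y \<in> \<real>"
  shows "deriv h x \<in> \<real>"
proof -
  have "((\<lambda>t. (h (x + t) - h x) / t) \<longlongrightarrow> deriv h x) (at 0)"
    using h[THEN field_differentiable_derivI] by (simp add: DERIV_def)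
  moreover have "filterlim (complex_of_real) (at 0) (at_right 0)"
    by (rule filterlim_atI) (auto intro!: tendsto_eq_intros simp: eventually_at_filter)
  ultimately have "((\<lambda>t. (h (x + of_real t) - h x) / of_real t) \<longlongrightarrow> deriv h x) (at_right 0)"
    by (rule filterlim_compose)
  then show ?thesis
  proof (rule real_lim)
    show "\<forall>\<^sub>F t in at_right 0. t \<in> {0<..<e}"
      by (rule eventually_at_right_real[OF e])
    show "(h (x + of_real t) - h x) / of_real t \<in> \<real>" if "t \<in> {0<..<e}" for t
      using that x e by (intro Reals_divide Reals_diff real Reals_add) auto
  qed simp
qed

lemma complex_of_rat_Reals [simp]: "complex_of_rat c \<in> \<real>"
  by (cases c) (simp add: of_rat_rat)

context power_series
begin

lemma S_summable:
  assumes "norm w \<le> r" "norm p \<le> 1" "norm (x * p) \<le> 1/2"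
  shows "summable (\<lambda>n. if n < 2 then 0 else f n * (w ^ (n - 1) * (p ^ n - 1)) / (1 - x * p ^ (n - 1)))"
proof -
  have "summable (\<lambda>n. (if n < 2 then 0 else f n * (w ^ (n - 1) * (p ^ n - 1))) /
      (1 - (if n < 2 then 0 else x * p ^ (n - 1))))"
    by (rule fraction_series(2)[of "{()}" "\<lambda>n _. if n < 2 then 0 else f n * (w ^ (n - 1) * (p ^ n - 1))"
          "\<lambda>n. 2 * r / r\<^sup>2 * (norm (f n) * r ^ n)" "\<lambda>n _. if n < 2 then 0 else x * p ^ (n - 1)" "()"])
      (use assms in \<open>auto simp only: intro!: S_numerator_bound[of _ r] S_denominator_bound S_majorant_summable\<close>)
  also have "(\<lambda>n. (if n < 2 then 0 else f n * (w ^ (n - 1) * (p ^ n - 1))) /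
      (1 - (if n < 2 then 0 else x * p ^ (n - 1)))) =
      (\<lambda>n. if n < 2 then 0 else f n * (w ^ (n - 1) * (p ^ n - 1)) / (1 - x * p ^ (n - 1)))"
    by (intro ext) auto
  finally show ?thesis .
qed

lemma K_Reals:
  assumes f: "\<And>n. f n \<in> \<real>" and real: "x \<in> \<real>" "u \<in> \<real>" "w \<in> \<real>" "p \<in> \<real>"
    and "norm w \<le> r" "norm p \<le> 1" "norm (x * p) \<le> 1/2"
  shows "K x u w p \<in> \<real>"
proof -
  have "F w \<in> \<real>"
    unfolding F_def using F_sums[OF \<open>norm w \<le> r\<close>] real
    by (intro Reals_suminf sums_summable[OF F_sums] Reals_mult f Reals_power assms)
  moreover have "S x w p \<in> \<real>"
    unfolding S_def
  proof (rule Reals_suminf[OF S_summable])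
    show "(if n < 2 then 0 else f n * (w ^ (n - 1) * (p ^ n - 1)) / (1 - x * p ^ (n - 1))) \<in> \<real>" for n
      by (cases "n < 2") (auto intro!: Reals_mult Reals_divide Reals_diff Reals_power f real)
  qed fact+
  ultimately show ?thesis
    unfolding K_def by (intro Reals_mult Reals_add Reals_diff f real) auto
qed

lemma K_at_0: "K 0 u w p = F w"
  by (simp add: K_def)

end

locale euler_power = power_series "\<lambda>n. of_rat (fcoeff k n)" r for k r +
  assumes F_eq: "norm w \<le> r \<Longrightarrow> F w = euler_Phi w ^ k"
begin

lemma norm_power_le_r:
  fixes q :: complex
  assumes "norm q \<le> r" "n > 0"
  shows "norm (q ^ n) \<le> r" "norm (q ^ n) \<le> norm q"
proof -
  have "norm q ^ n \<le> norm q ^ 1" using assms r by (intro power_decreasing) auto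
  with assms show "norm (q ^ n) \<le> r" "norm (q ^ n) \<le> norm q" by (simp_all add: norm_power)
qed

lemma M_eq:
  assumes "norm (q ^ a) \<le> r"
  shows "M a k x q = K x 1 (q ^ a) (q ^ a)"
  unfolding M_def K_def S_def F_eq[OF assms] power_mult by (simp add: algebra_simps)

text \<open>Since \<open>q powi (n - a) = u * q ^ (n - 1)\<close> for
  \<open>u = q powi (1 - a)\<close>, the factor \<open>u\<close> comes out of the sum; the bound on
  \<open>x * q ^ a\<close> provides the summability for this.\<close>

lemma N_eq:
  assumes q: "q \<noteq> 0" "norm q \<le> r" and a: "a > 0" and x: "norm (x * q ^ a) \<le> 1/2"
  shows "N a k x q = K x (q powi (1 - int a)) q (q ^ a)"
proof -
  let ?u = "q powi (1 - int a)"
  have u: "?u * q ^ a = q"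
    using q by (simp add: power_int_diff)
  have "q powi (int n - int a) = ?u * q ^ (n - 1)" if n0: "n > 0" for n
  proof -
    obtain m where n: "n = Suc m" using n0 by (cases n) auto
    have "int n - int a = (1 - int a) + int m" by (simp add: n)
    then have "q powi (int n - int a) = q powi ((1 - int a) + int m)" by (rule arg_cong)
    also have "\<dots> = ?u * q powi (int m)" by (rule power_int_add) (use q in simp)
    also have "q powi (int m) = q ^ (n - 1)" by (simp add: n)
    finally show ?thesis .
  qed
  then have "(\<lambda>n. if n < 2 then 0 else of_rat (fcoeff k n) * (q powi (int n - int a) * (q ^ (a * n) - 1))
        / (1 - x * q ^ (a * (n - 1)))) =
      (\<lambda>n. ?u * (if n < 2 then 0 else of_rat (fcoeff k n) * (q ^ (n - 1) * ((q ^ a) ^ n - 1)) / (1 - x * (q ^ a) ^ (n - 1))))"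
    by (auto simp: power_mult fun_eq_iff)
  moreover have "norm (q ^ a) \<le> 1" using norm_power_le_r[OF q(2) a] r by simp
  ultimately have sum: "(\<Sum>n. if n < 2 then 0 else of_rat (fcoeff k n) * (q powi (int n - int a) * (q ^ (a * n) - 1))
        / (1 - x * q ^ (a * (n - 1)))) = ?u * S x q (q ^ a)"
    unfolding S_def using suminf_mult[OF S_summable[OF q(2) _ x]] by simp
  have qu: "q - ?u = ?u * (q ^ a - 1)"
    using u by (simp add: algebra_simps)
  show ?thesis
    unfolding N_def K_def F_eq[OF q(2)] sum qu by (simp only: distrib_left mult.assoc mult.left_commute add.assoc)
qed

text \<open>Numerator and denominator are Lambert sums with \<open>w = q\<close> and
  \<open>w = Q\<close>, and the same pole-removing factor, nonzero here, cancels. The second claim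
  matters because \<open>J_continuation\<close> prescribes values only where \<open>J_den\<close> is
  nonzero.\<close>

lemma J_eq:
  assumes q: "q \<noteq> 0" "norm q \<le> r" and a: "a > 0" and z: "norm z < 1 / norm q ^ a"
  shows "J a k z q = q powi (1 - int a) * K (z * (q ^ a)\<^sup>2) (q powi (1 - int a)) q (q ^ a) /
    K (z * (q ^ a)\<^sup>2) 1 (q ^ a) (q ^ a)"
    and "J_den a k z q = 0 \<longleftrightarrow> K (z * (q ^ a)\<^sup>2) 1 (q ^ a) (q ^ a) = 0"
proof -
  define p where "p = q ^ a"
  have p: "norm p \<le> r" "norm p \<le> 1" "p \<noteq> 0"
    using norm_power_le_r[OF q(2) a] r q by (auto simp: p_def)
  have zp: "norm (z * p) < 1"
    using z q by (simp add: p_def norm_mult norm_power field_simps)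
  have pm: "norm (w * p ^ m) \<le> r" if "norm w \<le> r" for w m
    using mult_mono[OF that power_le_one[of "norm p" m]] p r by (simp add: norm_mult norm_power)
  let ?D = "\<lambda>w. \<Sum>n. of_rat (fcoeff k n) * w ^ (n + 1) / (1 - z * p ^ (n + 1))"
  have num: "(\<Sum>m. z ^ m * (w * p ^ m) * euler_Phi (w * p ^ m) ^ k) = ?D w" if "norm w \<le> r" for w
    using sums_unique[OF lambert_sums(2)[OF that p(2) zp]] F_eq[OF pm[OF that]] by simp
  have den: "J_den a k z q = ?D p"
    unfolding J_den_def num[OF p(1), symmetric] by (simp add: p_def power_add flip: power_mult)
  have J: "J a k z q = ?D q / ?D p"
    unfolding J_def den J_num_def num[OF q(2), symmetric] by (simp add: p_def power_add flip: power_mult)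
  have "norm (z * p\<^sup>2) < 1"
    using mult_left_mono[OF p(2), of "norm (z * p)"] zp by (simp add: norm_mult power2_eq_square mult.assoc)
  then have t: "(1 - z * p\<^sup>2) * (1 - z * p) \<noteq> 0"
    using zp by auto
  have u: "q powi (1 - int a) = q / p"
    using q by (simp add: p_def power_int_diff)
  have "J a k z q = ((1 - z * p\<^sup>2) * (1 - z * p) * ?D q) / ((1 - z * p\<^sup>2) * (1 - z * p) * ?D p)"
    unfolding J using t by (rule mult_divide_mult_cancel_left[symmetric])
  also have "\<dots> = (q * K (z * p\<^sup>2) (q / p) q p) / (p * K (z * p\<^sup>2) (p / p) p p)"
    unfolding lambert_eq_K[OF q(2) p(2,3) zp] lambert_eq_K[OF p(1) p(2,3) zp] ..
  finally show "J a k z q = q powi (1 - int a) * K (z * (q ^ a)\<^sup>2) (q powi (1 - int a)) q (q ^ a) /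
      K (z * (q ^ a)\<^sup>2) 1 (q ^ a) (q ^ a)"
    using p(3) unfolding p_def[symmetric] u by simp
  have "(1 - z * p\<^sup>2) * (1 - z * p) * J_den a k z q = p * K (z * p\<^sup>2) 1 p p"
    using lambert_eq_K[OF p(1) p(2,3) zp] p(3) unfolding den by simp
  with t p(3) show "J_den a k z q = 0 \<longleftrightarrow> K (z * (q ^ a)\<^sup>2) 1 (q ^ a) (q ^ a) = 0"
    unfolding p_def[symmetric] by (metis mult_eq_0_iff)
qed

end

text \<open>Gathers what smallness provides for one fixed \<open>q\<close>. In
  \<open>deriv_near\<close> and \<open>dominant\<close> the limits are \<open>k - 1\<close> and
  \<open>k * \<xi>\<close>; an error of at most half of them suffices for nonvanishing and for
  signs.\<close>

locale pole_setting = euler_power k r for k r +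
  fixes a :: nat and c :: real and q \<xi> :: complex
  assumes a: "a \<ge> 2" and k: "k \<ge> 2" and q: "q \<noteq> 0" "norm q < r"
    and c: "0 < c" "(c + 2) * norm (q ^ a) \<le> 1/2"
    and \<xi>: "norm \<xi> < c" "x0 a k q = \<xi>" "norm (q ^ a) ^ 2 < norm \<xi>"
    and \<xi>_real: "q \<in> \<real> \<Longrightarrow> \<xi> \<in> \<real>" and \<xi>_neg: "Re \<xi> < 0"
    and root: "\<And>y. norm y \<le> c \<Longrightarrow> K y 1 (q ^ a) (q ^ a) = 0 \<longleftrightarrow> y = \<xi>"
    and deriv_near: "norm (deriv (\<lambda>y. K y 1 (q ^ a) (q ^ a)) \<xi> - (of_nat k - 1)) \<le> (real k - 1) / 2"
    and dominant: "norm (q ^ (a - 1) * K \<xi> (q powi (1 - int a)) q (q ^ a) - of_nat k * \<xi>) \<le> real k / 2 * norm \<xi>"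
begin

abbreviation Q :: complex where "Q \<equiv> q ^ a"

abbreviation u :: complex where "u \<equiv> q powi (1 - int a)"

abbreviation \<zeta> :: complex where "\<zeta> \<equiv> z0 a k q"

definition U :: "complex \<Rightarrow> complex" where "U z = u * K (z * Q\<^sup>2) u q Q"

definition V :: "complex \<Rightarrow> complex" where "V z = K (z * Q\<^sup>2) 1 Q Q"

abbreviation D :: complex where "D \<equiv> deriv (\<lambda>y. K y 1 Q Q) \<xi>"

lemma Q: "Q \<noteq> 0" "norm Q < r" "norm Q \<le> 1"
proof -
  have "norm Q \<le> norm q" using norm_power_le_r(2)[of q a] q a by simp
  with q r show "norm Q < r" "norm Q \<le> 1" by auto
qed (use q in simp)

lemma \<zeta>_eq: "\<zeta> = \<xi> / Q\<^sup>2" "\<zeta> * Q\<^sup>2 = \<xi>"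
  using Q by (simp_all add: z0_def \<xi>(2))

lemma norm_\<zeta>: "1 < norm \<zeta>" "norm \<zeta> < c / (norm Q)\<^sup>2"
  using Q \<xi> by (simp_all add: \<zeta>_eq(1) norm_divide norm_power divide_strict_right_mono)

lemma norm_\<xi>: "0 < norm \<xi>"
  using \<xi>(3) zero_le_power2[of "norm Q"] by linarith

lemma small_yQ:
  assumes "norm y \<le> c + 2"
  shows "norm (y * Q) \<le> 1/2"
proof -
  have "norm y * norm Q \<le> (c + 2) * norm Q" using assms by (rule mult_right_mono) simp
  with c(2) show ?thesis unfolding norm_mult by linarith
qed

lemma K_ball: "norm w < r \<Longrightarrow> (\<lambda>y. K y v w Q) holomorphic_on ball 0 (c + 2)"
  by (rule K_holomorphic) (use Q(3) small_yQ in \<open>auto intro!: holomorphic_intros\<close>)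

text \<open>In the variable \<open>z\<close>, with \<open>c + 1\<close> chosen between
  \<open>c\<close> and \<open>c + 2\<close>: the open disc contains the closed one of radius
  \<open>c / (norm Q)\<^sup>2\<close>.\<close>

lemma K_scaled:
  assumes w: "norm w < r"
  shows "(\<lambda>z. K (z * Q\<^sup>2) v w Q) holomorphic_on ball 0 ((c + 1) / (norm Q)\<^sup>2)"
proof -
  have "((\<lambda>y. K y v w Q) \<circ> (\<lambda>z. z * Q\<^sup>2)) holomorphic_on ball 0 ((c + 1) / (norm Q)\<^sup>2)"
  proof (rule holomorphic_on_compose_gen[OF _ K_ball[OF w]])
    show "(\<lambda>z. z * Q\<^sup>2) ` ball 0 ((c + 1) / (norm Q)\<^sup>2) \<subseteq> ball 0 (c + 2)"
      using Q(1) by (auto simp: norm_mult norm_power field_simps)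
  qed (intro holomorphic_intros)
  then show ?thesis by (simp add: o_def)
qed

lemma U_holomorphic: "U holomorphic_on ball 0 ((c + 1) / (norm Q)\<^sup>2)"
  unfolding U_def by (intro holomorphic_intros K_scaled q)

lemma V_holomorphic: "V holomorphic_on ball 0 ((c + 1) / (norm Q)\<^sup>2)"
  unfolding V_def by (intro K_scaled Q)

lemma V_eq_0_iff: "norm z \<le> c / (norm Q)\<^sup>2 \<Longrightarrow> V z = 0 \<longleftrightarrow> z = \<zeta>"
proof -
  assume "norm z \<le> c / (norm Q)\<^sup>2"
  then have "norm (z * Q\<^sup>2) \<le> c" using Q(1) by (simp add: norm_mult norm_power field_simps)
  from root[OF this] show ?thesis
    unfolding V_def \<zeta>_eq(1) using Q(1) by (auto simp: field_simps)
qed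

lemma D_pos: "0 < Re D"
proof -
  have "\<bar>Re (D - (of_nat k - 1))\<bar> \<le> (real k - 1) / 2"
    using abs_Re_le_cmod deriv_near by (rule order_trans)
  then have "\<bar>Re D - (real k - 1)\<bar> \<le> (real k - 1) / 2" by simp
  moreover have "0 < e" if "\<bar>e - (n - 1)\<bar> \<le> (n - 1) / 2" "2 \<le> n" for e n :: real
    using abs_le_D2[OF that(1)] that(2) by (simp add: field_simps)
  moreover have "2 \<le> real k" using k by simp
  ultimately show ?thesis by blast
qed

lemma K_differentiable: "(\<lambda>y. K y 1 Q Q) field_differentiable at \<xi>"
  by (rule holomorphic_on_imp_differentiable_at[OF K_ball[OF Q(2)] open_ball]) (use \<xi>(1) in simp)

lemma deriv_V: "deriv V \<zeta> = Q\<^sup>2 * D"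
proof -
  have "(\<lambda>y. K y 1 Q Q) field_differentiable at (\<zeta> * Q\<^sup>2)"
    unfolding \<zeta>_eq(2) by (rule K_differentiable)
  then have "((\<lambda>y. K y 1 Q Q) has_field_derivative D) (at (\<zeta> * Q\<^sup>2))"
    unfolding \<zeta>_eq(2) by (rule field_differentiable_derivI)
  moreover have "((\<lambda>z. z * Q\<^sup>2) has_field_derivative Q\<^sup>2) (at \<zeta>)"
    by (auto intro!: derivative_eq_intros)
  ultimately have "(V has_field_derivative D * Q\<^sup>2) (at \<zeta>)"
    unfolding V_def by (rule DERIV_chain2)
  then show ?thesis by (simp add: DERIV_imp_deriv mult.commute)
qed

lemma deriv_V_nonzero: "deriv V \<zeta> \<noteq> 0"
  using D_pos Q(1) by (auto simp: deriv_V)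

lemma u: "u \<noteq> 0" "u * q ^ (a - 1) = 1"
proof -
  show "u \<noteq> 0" using q by simp
  have "u * q ^ (a - 1) = q powi (1 - int a) * q powi (int (a - 1))" by simp
  also have "\<dots> = q powi ((1 - int a) + int (a - 1))"
    by (rule power_int_add[symmetric]) (use q in simp)
  also have "(1 - int a) + int (a - 1) = 0" using a by (simp add: of_nat_diff)
  finally show "u * q ^ (a - 1) = 1" by simp
qed

text \<open>Guarantees that the zero of the denominator is not cancelled by the numerator.\<close>

lemma K_\<xi>_nonzero: "K \<xi> u q Q \<noteq> 0"
proof
  assume "K \<xi> u q Q = 0"
  then have "real k * norm \<xi> \<le> real k / 2 * norm \<xi>"
    using dominant by (simp add: norm_mult)
  with k norm_\<xi> show False by simp
qed

lemma N_\<xi>: "N a k \<xi> q = K \<xi> u q Q"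
proof (rule N_eq)
  show "norm (\<xi> * Q) \<le> 1/2" using \<xi>(1) by (intro small_yQ) simp
qed (use q a in auto)

lemma varrho_eq: "varrho a k q = - K \<xi> u q Q / D"
proof -
  have "(\<lambda>y. M a k y q) = (\<lambda>y. K y 1 Q Q)"
    using Q(2) by (intro ext M_eq) simp
  then show ?thesis by (simp add: varrho_def \<xi>(2) N_\<xi>)
qed

lemma residue_eq: "U \<zeta> / deriv V \<zeta> = - (u * varrho a k q / Q\<^sup>2)"
  unfolding deriv_V varrho_eq U_def \<zeta>_eq(2) by simp

lemma J_eq_UV: "norm z < 1 / norm q ^ a \<Longrightarrow> J a k z q = U z / V z"
  unfolding U_def V_def using q a by (intro J_eq(1)) auto

lemma J_continuation_UV: "J_continuation a k q (\<lambda>z. U z / V z)"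
  unfolding J_continuation_def
proof (intro conjI allI impI)
  have scale: "(\<lambda>z. K (z * Q\<^sup>2) v w Q) meromorphic_on UNIV" if "norm w < r" for v w
  proof -
    have "norm Q < 1" using Q r by simp
    with that have "(\<lambda>y. K y v w Q) meromorphic_on UNIV" by (intro K_meromorphic) auto
    then show ?thesis
      by (rule meromorphic_on_compose[where f = "\<lambda>z. z * Q\<^sup>2"]) (auto intro!: analytic_intros)
  qed
  show "(\<lambda>z. U z / V z) meromorphic_on UNIV"
    unfolding U_def V_def using q Q by (intro meromorphic_intros scale)
qed (simp add: J_eq_UV)

text \<open>The two functions are compared on the unit disc, where the series converge and
  \<open>V\<close> has no zero because \<open>norm \<zeta> > 1\<close>; the identity theorem does
  the rest.\<close>

lemma continuation_unique:
  assumes "J_continuation a k q G"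
  shows "\<forall>\<^sub>F w in at z. G w = U w / V w"
proof (rule meromorphic_identity)
  show "G meromorphic_on UNIV" "(\<lambda>z. U z / V z) meromorphic_on UNIV"
    using assms J_continuation_UV by (simp_all add: J_continuation_def)
  have "\<forall>\<^sub>F w in at 0. w \<in> ball (0::complex) 1"
    by (intro eventually_at_in_open') auto
  then show "\<forall>\<^sub>F w in at 0. G w = U w / V w"
  proof eventually_elim
    case (elim w)
    have "1 \<le> 1 / norm q ^ a" using Q(3) q by (simp add: norm_power)
    with elim have w: "norm w < 1 / norm q ^ a" by simp
    have "norm w \<le> c / (norm Q)\<^sup>2" "w \<noteq> \<zeta>" using elim norm_\<zeta> by auto
    then have "V w \<noteq> 0" using V_eq_0_iff by blast
    then have "J_den a k w q \<noteq> 0"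
      unfolding V_def using J_eq(2)[OF q(1) _ _ w] q(2) a by simp
    with w have "G w = J a k w q" using assms by (simp add: J_continuation_def)
    with w show "G w = U w / V w" by (simp add: J_eq_UV)
  qed
qed

lemma continuation_pole:
  assumes "J_continuation a k q G"
  shows "{z. norm z \<le> c / (norm Q)\<^sup>2 \<and> is_pole G z} = {\<zeta>}" "zorder G \<zeta> = -1"
    "residue G \<zeta> = - (u * varrho a k q / Q\<^sup>2)"
proof -
  have U\<zeta>: "U \<zeta> \<noteq> 0" using K_\<xi>_nonzero u by (simp add: U_def \<zeta>_eq(2))
  have R: "c / (norm Q)\<^sup>2 < (c + 1) / (norm Q)\<^sup>2"
    using Q(1) by (intro divide_strict_right_mono) auto
  have V0: "V \<zeta> = 0" using V_eq_0_iff[of \<zeta>] norm_\<zeta> by simp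
  have Vz: "z = \<zeta>" if "norm z \<le> c / (norm Q)\<^sup>2" "V z = 0" for z
    using V_eq_0_iff[OF that(1)] that(2) by (rule iffD1)
  note pole = quotient_simple_pole[OF V_holomorphic U_holomorphic norm_\<zeta>(2) R V0 deriv_V_nonzero _ U\<zeta>
      continuation_unique[OF assms]]
  show "{z. norm z \<le> c / (norm Q)\<^sup>2 \<and> is_pole G z} = {\<zeta>}" "zorder G \<zeta> = -1"
    by (rule pole(1,2), erule (1) Vz)+
  have "residue G \<zeta> = U \<zeta> / deriv V \<zeta>"
    by (rule pole(3), erule (1) Vz)
  then show "residue G \<zeta> = - (u * varrho a k q / Q\<^sup>2)" by (simp only: residue_eq)
qed

lemma W_asymptotics:
  assumes r0: "norm \<zeta> < r0" "r0 < c / (norm Q)\<^sup>2"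
  shows "(\<lambda>d. W a d q k - T a k q - main_term a k q d) \<in> O(\<lambda>d. of_real r0 powi (- int d))"
proof -
  define \<rho> where "\<rho> = U \<zeta> / deriv V \<zeta>"
  have sub: "ball 0 (c / (norm Q)\<^sup>2) \<subseteq> ball (0::complex) ((c + 1) / (norm Q)\<^sup>2)"
    by (intro subset_ball divide_right_mono) auto
  have V0: "V \<zeta> = 0" using V_eq_0_iff[of \<zeta>] norm_\<zeta> by simp
  have Vz: "z = \<zeta>" if "norm z < c / (norm Q)\<^sup>2" "V z = 0" for z
    using V_eq_0_iff[OF less_imp_le[OF that(1)]] that(2) by (rule iffD1)
  obtain H where H: "H holomorphic_on ball 0 (c / (norm Q)\<^sup>2)"
    and UV: "\<And>z. \<lbrakk>norm z < c / (norm Q)\<^sup>2; z \<noteq> \<zeta>\<rbrakk> \<Longrightarrow> U z / V z = \<rho> / (z - \<zeta>) + H z"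
    using quotient_principal_part[OF holomorphic_on_subset[OF V_holomorphic sub]
      holomorphic_on_subset[OF U_holomorphic sub] norm_\<zeta>(2) V0 deriv_V_nonzero Vz]
    unfolding \<rho>_def by blast
  have J: "J a k z q = \<rho> / (z - \<zeta>) + H z" if "norm z \<le> 1" for z
  proof -
    have "norm q ^ a < 1" using Q r by (simp add: norm_power)
    then have "1 < 1 / norm q ^ a" using q by (simp add: field_simps)
    with that have "norm z < 1 / norm q ^ a" by linarith
    moreover have "norm z < c / (norm Q)\<^sup>2" "z \<noteq> \<zeta>" using that norm_\<zeta> by auto
    ultimately show ?thesis using J_eq_UV UV by simp
  qed
  \<comment> \<open>At \<open>x = 0\<close> the function \<open>K\<close> reduces to
    \<open>F\<close>, so \<open>T\<close> is the value of \<open>U / V\<close> at the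
    origin.\<close>
  have T: "T a k q = \<rho> / (0 - \<zeta>) + H 0"
  proof -
    have "U 0 / V 0 = \<rho> / (0 - \<zeta>) + H 0"
      using norm_\<zeta> by (intro UV) auto
    then show ?thesis
      using F_eq q(2) Q(2) by (simp add: T_def U_def V_def K_at_0)
  qed
  obtain B where B: "\<And>d. d > 0 \<Longrightarrow> norm ((\<Sum>z | z ^ d = 1. H z) / of_nat d - H 0) \<le> B * r0 powi (- int d)"
    using roots_of_unity_average_bound[OF H, of r0] r0 norm_\<zeta>(1) by fastforce
  have main: "main_term a k q d = - \<rho> / \<zeta> * (\<zeta> powi (- int d) / (1 - \<zeta> powi (- int d)))" for d
  proof -
    have "- \<rho> / \<zeta> = u * varrho a k q / Q\<^sup>2 / \<zeta>" unfolding \<rho>_def residue_eq by simp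
    also have "\<dots> = u * varrho a k q / \<xi>" unfolding \<zeta>_eq(1) using Q(1) by simp
    finally show ?thesis unfolding main_term_def \<xi>(2) by simp
  qed
  have "norm (W a d q k - T a k q - main_term a k q d) \<le> B * norm (of_real r0 powi (- int d) :: complex)"
    if d: "d > 0" for d
  proof -
    have "norm z = 1" if "z ^ d = 1" for z :: complex
      using that d power_eq_1_iff by blast
    then have "(\<Sum>z | z ^ d = 1. J a k z q) = (\<Sum>z | z ^ d = 1. \<rho> * (1 / (z - \<zeta>)) + H z)"
      by (intro sum.cong) (auto simp: J)
    then have "W a d q k = \<rho> * ((\<Sum>z | z ^ d = 1. 1 / (z - \<zeta>)) / of_nat d) + (\<Sum>z | z ^ d = 1. H z) / of_nat d"
      unfolding W_def by (simp only: sum.distrib sum_distrib_left[symmetric] add_divide_distrib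
          times_divide_eq_right[of _ "sum _ _", symmetric])
    \<comment> \<open>The index-0 parts \<open>- \<rho> / \<zeta>\<close> and \<open>H 0\<close>
      make up \<open>T\<close>, and the rest of the pole average is the main term.\<close>
    then have "W a d q k - T a k q - main_term a k q d = (\<Sum>z | z ^ d = 1. H z) / of_nat d - H 0"
      unfolding roots_of_unity_average_pole[OF d norm_\<zeta>(1)] T main by (simp add: algebra_simps)
    then show ?thesis using B[OF d] r0 norm_\<zeta>(1) by (simp add: norm_power_int)
  qed
  then show ?thesis
    by (intro bigoI[of _ B] eventually_sequentiallyI[of 1]) auto
qed

text \<open>The factor \<open>u\<close> occurs twice, in front of \<open>J\<close> and inside
  \<open>N\<close>, so its sign disappears: the coefficient is \<open>- u^2 * s / D\<close> with
  \<open>s\<close> near \<open>k\<close> and \<open>D\<close> near \<open>k - 1\<close>, both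
  positive.\<close>

lemma leading_coefficient_neg:
  assumes q_real: "q \<in> \<real>"
  obtains \<kappa> where "\<kappa> < 0" "u * varrho a k q / \<xi> = of_real \<kappa>"
proof -
  obtain t where t: "q = of_real t" using q_real by (rule Reals_cases)
  define u' where "u' = t powi (1 - int a)"
  have u': "u = of_real u'" by (simp add: t u'_def of_real_power_int)
  then have "u' \<noteq> 0" using u(1) by auto
  have f: "complex_of_rat (fcoeff k n) \<in> \<real>" for n by simp
  have K_real: "K y v w Q \<in> \<real>"
    if "y \<in> \<real>" "v \<in> \<real>" "w \<in> \<real>" "norm w < r" "norm y \<le> c + 2" for y v w
    using that Q q_real by (intro K_Reals f small_yQ Reals_power) auto
  have "D \<in> \<real>"
  proof (rule Reals_deriv[OF _ \<xi>_real[OF q_real], of _ 1])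
    show "(\<lambda>y. K y 1 Q Q) field_differentiable at \<xi>"
      by (rule K_differentiable)
    fix y :: complex assume y: "y \<in> \<real>" "norm (y - \<xi>) < 1"
    then have "norm y \<le> c + 2" using norm_triangle_sub[of y \<xi>] \<xi>(1) by linarith
    then show "K y 1 Q Q \<in> \<real>" using y Q q_real by (intro K_real Reals_power) auto
  qed simp
  then obtain D' where D': "D = of_real D'" by (rule Reals_cases)
  have "D' > 0" using D_pos unfolding D' by simp
  define s where "s = q ^ (a - 1) * K \<xi> u q Q / \<xi>"
  have "s \<in> \<real>" unfolding s_def
    using \<xi>(1) \<xi>_real[OF q_real] q_real q(2) u' by (intro Reals_divide Reals_mult Reals_power K_real) auto
  then obtain s' where s': "s = of_real s'" by (rule Reals_cases)
  have "\<xi> \<noteq> 0" using norm_\<xi> by simp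
  then have "norm (s - of_nat k) = norm (q ^ (a - 1) * K \<xi> u q Q - of_nat k * \<xi>) / norm \<xi>"
    unfolding s_def by (simp add: norm_divide[symmetric] diff_divide_distrib)
  also have "\<dots> \<le> real k / 2" using dominant norm_\<xi> by (simp add: field_simps)
  finally have "\<bar>s' - real k\<bar> \<le> real k / 2"
    unfolding s' by (metis norm_of_real of_real_diff of_real_of_nat_eq)
  from abs_le_D2[OF this] have "s' > 0" using k by (simp add: field_simps)
  have "K \<xi> u q Q = u * (q ^ (a - 1) * K \<xi> u q Q)"
    using u(2) by (simp add: mult.assoc[symmetric])
  also have "\<dots> = u * (s * \<xi>)" using \<open>\<xi> \<noteq> 0\<close> by (simp add: s_def)
  finally have "u * varrho a k q / \<xi> = of_real (- (u'\<^sup>2 * s' / D'))"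
    unfolding varrho_eq D' using \<open>\<xi> \<noteq> 0\<close> by (simp add: s' u' power2_eq_square)
  moreover have "- (u'\<^sup>2 * s' / D') < 0"
    using \<open>u' \<noteq> 0\<close> \<open>s' > 0\<close> \<open>D' > 0\<close> by simp
  ultimately show ?thesis using that by blast
qed

lemma \<zeta>_real_less:
  assumes q_real: "q \<in> \<real>"
  obtains t where "t > 1" "\<zeta> = of_real (- t)"
proof -
  obtain x where x: "\<xi> = of_real x" using \<xi>_real[OF q_real] by (rule Reals_cases)
  obtain p where p: "Q = of_real p" using Reals_power[OF q_real] by (rule Reals_cases)
  have \<zeta>: "\<zeta> = of_real (x / p\<^sup>2)" by (simp add: \<zeta>_eq(1) x p)
  have "x < 0" using \<xi>_neg x by simp
  moreover have "p\<^sup>2 > 0" using Q(1) p by auto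
  ultimately have "x / p\<^sup>2 < 0" by (simp add: divide_neg_pos)
  moreover have "1 < \<bar>x / p\<^sup>2\<bar>" using norm_\<zeta>(1) unfolding \<zeta> norm_of_real .
  ultimately show ?thesis using \<zeta> by (intro that[of "- (x / p\<^sup>2)"]) auto
qed

text \<open>As \<open>\<zeta> < -1\<close>, its power \<open>y\<close> with exponent
  \<open>- d\<close> has sign \<open>(-1)^d\<close> and modulus below 1. Thus
  \<open>y / (1 - y)\<close> has the sign of \<open>y\<close>, and the negative coefficient reverses
  it.\<close>

lemma main_term_sign:
  assumes q_real: "q \<in> \<real>" and d: "d > 0"
  shows "main_term a k q d \<in> \<real>" "sgn (Re (main_term a k q d)) = (-1) ^ (d - 1)"
proof -
  obtain \<kappa> where \<kappa>: "\<kappa> < 0" "u * varrho a k q / \<xi> = of_real \<kappa>"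
    using leading_coefficient_neg[OF q_real] .
  obtain t where t: "t > 1" "\<zeta> = of_real (- t)"
    using \<zeta>_real_less[OF q_real] .
  define s where "s = (1 / t) ^ d"
  have s: "0 < s" "s < 1"
    using t(1) d power_strict_decreasing[of 0 d "1 / t"] by (auto simp: s_def)
  define y where "y = (-1) ^ d * s"
  have "\<zeta> powi (- int d) = inverse \<zeta> ^ d"
    by (simp add: power_int_minus power_inverse)
  also have "inverse \<zeta> = of_real (- (1 / t))"
    by (simp add: t(2) inverse_eq_divide)
  also have "of_real (- (1 / t)) ^ d = complex_of_real y"
    unfolding y_def s_def by (simp only: of_real_power[symmetric] power_minus[of "1 / t"])
  finally have "\<zeta> powi (- int d) = of_real y" .
  then have main: "main_term a k q d = of_real (\<kappa> * (y / (1 - y)))"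
    unfolding main_term_def \<xi>(2) \<kappa>(2) by simp
  then show "main_term a k q d \<in> \<real>" by simp
  show "sgn (Re (main_term a k q d)) = (-1) ^ (d - 1)"
  proof (cases "even d")
    case True
    then have "sgn (\<kappa> * (y / (1 - y))) = -1"
      using s \<kappa>(1) by (simp add: y_def sgn_mult)
    moreover have "odd (d - 1)" using True d by simp
    ultimately show ?thesis unfolding main by simp
  next
    case False
    then have "sgn (\<kappa> * (y / (1 - y))) = 1"
      using s \<kappa>(1) by (simp add: y_def sgn_mult)
    moreover have "even (d - 1)" using False by simp
    ultimately show ?thesis unfolding main by simp
  qed
qed

end

section \<open>Choice of the threshold for \<open>q\<close> and assembly\<close>

theorem theorem3p1:
  fixes a k :: nat and c :: real
  assumes "a \<ge> 2" and "k \<ge> 2" and "c > 1 / (real k - 1)"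
  shows "(fps_conv_radius (complex_fps (x0_fps k)) > 0 \<and>
          eval_fps (complex_fps (x0_fps k)) analytic_on {0}) \<and>
    (\<forall>\<^sub>F q in at (0::complex).
       (\<exists>G. J_continuation a k q G) \<and>
       (\<forall>G. J_continuation a k q G \<longrightarrow>
          {z. norm z \<le> c / (norm (q ^ a))\<^sup>2 \<and> is_pole G z} = {z0 a k q} \<and>
          zorder G (z0 a k q) = -1 \<and>
          residue G (z0 a k q) = - (q powi (1 - int a) * varrho a k q / (q ^ a)\<^sup>2))) \<and>
    (\<exists>E. E \<in> O[at 0](\<lambda>q. q ^ a) \<and>
       (\<forall>\<^sub>F q in at (0::complex).
          z0 a k q = - ((1 + E q) / ((of_nat k - 1) * (q ^ a)\<^sup>2)))) \<and>
    (\<forall>\<^sub>F q in at_right (0::real).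
       z0 a k (of_real q) \<in> \<real> \<and> Re (z0 a k (of_real q)) < -1 \<and>
       (\<forall>r0::real. norm (z0 a k (of_real q)) < r0 \<and> r0 < c / (q ^ a)\<^sup>2 \<longrightarrow>
          (\<lambda>d. W a d (of_real q) k - T a k (of_real q) - main_term a k (of_real q) d)
            \<in> O(\<lambda>d. of_real r0 powi (- int d))) \<and>
       (\<forall>\<^sub>F d in sequentially.
          main_term a k (of_real q) d \<in> \<real> \<and>
          sgn (Re (main_term a k (of_real q) d)) = (-1) ^ (d - 1)))"
proof -
  have k1: "1 \<le> real k - 1" using \<open>k \<ge> 2\<close> by simp
  obtain r where r: "0 < r" "r < 1" "summable (\<lambda>n. norm (of_rat (fcoeff k n) :: complex) * r ^ n)"
    and Phi: "\<And>w. norm w \<le> r \<Longrightarrow> (\<lambda>n. of_rat (fcoeff k n) * w ^ n) sums euler_Phi w ^ k"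
    using euler_Phi_power_sums by blast
  interpret P: power_series "\<lambda>n. of_rat (fcoeff k n)" r
    by unfold_locales (use r fcoeff_0 in simp_all)
  interpret P: euler_power k r
    by unfold_locales (metis P.F_def Phi sums_unique)
  have b: "1 + complex_of_rat (fcoeff k 1) = - of_real (real k - 1)"
    unfolding fcoeff_1 by (simp add: of_rat_minus)
  have nb: "norm (1 + complex_of_rat (fcoeff k 1)) = real k - 1"
    unfolding b norm_minus_cancel norm_of_real using k1 by linarith
  have f1: "complex_of_rat (fcoeff k 1) \<noteq> -1"
    using nb k1 by auto
  obtain \<delta> X where \<delta>: "0 < \<delta>" "\<delta> \<le> r" "(c + 2) * \<delta> \<le> 1/2" and X: "X holomorphic_on ball 0 \<delta>"
    and X0: "X 0 = 1 / (1 + of_rat (fcoeff k 1))" and Xc: "\<And>Q. norm Q < \<delta> \<Longrightarrow> norm (X Q) < c"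
    and root: "\<And>Q x. \<lbrakk>norm Q < \<delta>; norm x \<le> c\<rbrakk> \<Longrightarrow> P.K x 1 Q Q = 0 \<longleftrightarrow> x = X Q"
    and der: "\<And>Q x. \<lbrakk>norm Q < \<delta>; norm x \<le> c\<rbrakk> \<Longrightarrow>
      norm (deriv (\<lambda>x. P.K x 1 Q Q) x + (1 + of_rat (fcoeff k 1))) \<le> norm (1 + complex_of_rat (fcoeff k 1)) / 2"
    using P.K_root[OF f1, of c] assms(3) unfolding nb by blast
  define m where "m = 1 / (real k - 1)"
  have m: "0 < m" using k1 by (simp add: m_def)
  have c0: "0 < c" using assms(3) m unfolding m_def by linarith
  have X0': "X 0 = of_real (- m)"
    unfolding X0 b m_def by (simp only: of_real_minus of_real_divide of_real_1 divide_minus_right)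
  have cQ: "(c + 2) * norm Q \<le> 1/2" if "norm Q < \<delta>" for Q :: complex
    using mult_left_mono[of "norm Q" \<delta> "c + 2"] that c0 \<delta>(3) by linarith
  have X_fps: "complex_fps (x0_fps k) = fps_expansion X 0"
  proof (rule x0_fps_eqI[OF P.K_root_formal[OF \<delta>(1,2) X]])
    fix Q :: complex assume Q: "norm Q < \<delta>"
    have "norm (X Q) * norm Q \<le> (c + 2) * norm Q"
      using Xc[OF Q] by (intro mult_right_mono) auto
    with cQ[OF Q] show "norm (X Q * Q) \<le> 1/2" unfolding norm_mult by linarith
    show "P.K (X Q) 1 Q Q = 0" using root[OF Q] Xc[OF Q] by simp
  next
    show "fcoeff k 0 = 1" by (rule fcoeff_0)
    show "fcoeff k 1 \<noteq> -1" using f1 by auto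
  qed
  have "X holomorphic_on eball 0 (ereal \<delta>)" using X by simp
  \<comment> \<open>Holomorphy on the disc of radius \<open>\<delta>\<close> shows that the formal
    root converges there and sums to \<open>X\<close>.\<close>
  note radius = conv_radius_fps_expansion[OF this, folded X_fps]
    and eval = eval_fps_expansion'[OF this, folded X_fps]
  have radius_pos: "fps_conv_radius (complex_fps (x0_fps k)) > 0"
    using \<delta>(1) radius by (meson ereal_less(2) less_le_trans)
  have x0: "x0 a k q = X (q ^ a)" if "norm (q ^ a) < \<delta>" for q
    using eval[of "q ^ a"] that unfolding x0_def by simp

  obtain D where D: "0 \<le> D"
    "\<And>x u v w p. \<lbrakk>norm x \<le> c; u * v = 1; norm w \<le> r; norm p \<le> 1; c * norm p \<le> 1/2\<rbrakk>
      \<Longrightarrow> norm (v * P.K x u w p + of_rat (fcoeff k 1) * x) \<le> D * (norm v + norm w + norm p)"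
    using P.K_dominant_bound[of c] c0 less_imp_le by blast
  have "isCont X 0"
    using X \<delta>(1) by (intro field_differentiable_imp_continuous_at holomorphic_on_imp_differentiable_at[of _ "ball 0 \<delta>"]) auto
  then obtain \<gamma> where \<gamma>: "0 < \<gamma>" "\<And>Q. norm Q < \<gamma> \<Longrightarrow> norm (X Q - X 0) < m / 2"
    using m unfolding continuous_at_eps_delta dist_norm by (metis diff_zero half_gt_zero)
  \<comment> \<open>\<open>\<gamma>\<close> keeps \<open>X\<close> within \<open>m / 2\<close> of
    its limit \<open>- m\<close>, so \<open>norm X > m / 2\<close>. The entry \<open>m / 2\<close>
    then gives \<open>norm Q ^ 2 < norm X\<close>, and the last one turns the error
    \<open>3 * (D + 1) * norm q\<close> into at most \<open>k / 2 * (m / 2)\<close>.\<close>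
  define \<epsilon> where "\<epsilon> = min (min \<delta> \<gamma>) (min (m / 2) (real k * m / (12 * (D + 1))))"
  have \<epsilon>: "0 < \<epsilon>" using \<delta>(1) \<gamma>(1) m D(1) k1 by (simp add: \<epsilon>_def)
  have setting: "pole_setting k r a c q (X (q ^ a))" if q: "q \<noteq> 0" "norm q < \<epsilon>" for q
  proof
    have q': "norm q < \<delta>" "norm q < \<gamma>" "norm q < m / 2" "norm q < real k * m / (12 * (D + 1))"
      using q(2) by (auto simp: \<epsilon>_def)
    then have "norm q < r" using \<delta>(2) by simp
    then have Qq: "norm (q ^ a) \<le> norm q" "norm (q ^ (a - 1)) \<le> norm q"
      using P.norm_power_le_r(2)[of q] \<open>a \<ge> 2\<close> by simp_all
    then have Q: "norm (q ^ a) < \<delta>" "norm (q ^ a) < \<gamma>" "norm (q ^ a) < m / 2" "norm (q ^ a) \<le> 1"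
      using q' \<open>norm q < r\<close> r(2) by auto
    have near: "norm (X (q ^ a) - of_real (- m)) < m / 2"
      using \<gamma>(2)[OF Q(2)] unfolding X0' .
    have lower: "m / 2 < norm (X (q ^ a))"
    proof -
      have "norm (complex_of_real (- m)) = m" using m by simp
      then have "m - norm (X (q ^ a)) \<le> norm (X (q ^ a) - of_real (- m))"
        using norm_triangle_ineq2[of "of_real (- m)" "X (q ^ a)"]
        by (simp only: norm_minus_commute[of "X (q ^ a)"])
      with near show ?thesis by linarith
    qed
    show "2 \<le> a" "2 \<le> k" "q \<noteq> 0" "norm q < r" "0 < c" by fact+
    show "(c + 2) * norm (q ^ a) \<le> 1/2" using cQ Q(1) .
    show "norm (X (q ^ a)) < c" using Xc Q(1) .
    show "x0 a k q = X (q ^ a)" using x0 Q(1) .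
    have "norm (q ^ a) ^ 2 \<le> norm (q ^ a)"
      using Q(4) mult_left_le[of "norm (q ^ a)" "norm (q ^ a)"] by (simp add: power2_eq_square)
    then show "norm (q ^ a) ^ 2 < norm (X (q ^ a))" using Q(3) lower by linarith
    show "X (q ^ a) \<in> \<real>" if "q \<in> \<real>"
      unfolding x0[OF Q(1), symmetric] x0_def eval_fps_def
    proof (rule Reals_suminf)
      have "ereal (norm (q ^ a)) < fps_conv_radius (complex_fps (x0_fps k))"
        using Q(1) radius by (meson ereal_less_le less_le_trans less_ereal.simps(1))
      then show "summable (\<lambda>n. fps_nth (complex_fps (x0_fps k)) n * (q ^ a) ^ n)"
        by (intro summable_fps)
    qed (use that in \<open>auto intro!: Reals_mult Reals_power\<close>)
    show "Re (X (q ^ a)) < 0"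
      using near abs_Re_le_cmod[of "X (q ^ a) - of_real (- m)"] m by simp
    show "P.K y 1 (q ^ a) (q ^ a) = 0 \<longleftrightarrow> y = X (q ^ a)" if "norm y \<le> c" for y
      using root Q(1) that .
    show "norm (deriv (\<lambda>y. P.K y 1 (q ^ a) (q ^ a)) (X (q ^ a)) - (of_nat k - 1)) \<le> (real k - 1) / 2"
      using der[OF Q(1) less_imp_le[OF Xc[OF Q(1)]]] unfolding nb unfolding b by (simp add: algebra_simps)
    have "norm (q ^ (a - 1) * P.K (X (q ^ a)) (q powi (1 - int a)) q (q ^ a) + of_rat (fcoeff k 1) * X (q ^ a))
        \<le> D * (norm (q ^ (a - 1)) + norm q + norm (q ^ a))"
    proof (rule D(2))
      have "q powi (1 - int a) = inverse (q ^ (a - 1))"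
        using \<open>a \<ge> 2\<close> by (simp add: power_int_def nat_diff_distrib power_inverse)
      then show "q powi (1 - int a) * q ^ (a - 1) = 1" using q(1) by simp
      show "c * norm (q ^ a) \<le> 1/2"
        using cQ[OF Q(1)] c0 norm_ge_zero[of "q ^ a"] unfolding distrib_right by linarith
    qed (use Q Xc \<open>norm q < r\<close> in \<open>auto intro: less_imp_le\<close>)
    also have "\<dots> \<le> (D + 1) * (3 * norm q)"
      using Qq D(1) by (intro mult_mono) auto
    also have "\<dots> \<le> (D + 1) * (3 * (real k * m / (12 * (D + 1))))"
      using q'(4) D(1) by (intro mult_left_mono) auto
    also have "\<dots> = real k / 2 * (m / 2)" using D(1) by (simp add: field_simps)
    also have "\<dots> \<le> real k / 2 * norm (X (q ^ a))" using lower by (intro mult_left_mono) auto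
    finally show "norm (q ^ (a - 1) * P.K (X (q ^ a)) (q powi (1 - int a)) q (q ^ a) - of_nat k * X (q ^ a))
        \<le> real k / 2 * norm (X (q ^ a))"
      unfolding fcoeff_1 by (simp add: of_rat_minus)
  qed
  have small: "\<forall>\<^sub>F q in at (0::complex). q \<noteq> 0 \<and> norm q < \<epsilon>"
    unfolding eventually_at using \<epsilon> by (intro exI[of _ \<epsilon>]) auto
  then have poles: "\<forall>\<^sub>F q in at (0::complex).
       (\<exists>G. J_continuation a k q G) \<and>
       (\<forall>G. J_continuation a k q G \<longrightarrow>
          {z. norm z \<le> c / (norm (q ^ a))\<^sup>2 \<and> is_pole G z} = {z0 a k q} \<and>
          zorder G (z0 a k q) = -1 \<and>
          residue G (z0 a k q) = - (q powi (1 - int a) * varrho a k q / (q ^ a)\<^sup>2))"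
  proof eventually_elim
    case (elim q)
    then interpret S: pole_setting k r a c q "X (q ^ a)" by (intro setting) auto
    show ?case using S.J_continuation_UV S.continuation_pole by blast
  qed
  have kc: "complex_of_nat k - 1 \<noteq> 0"
    using \<open>k \<ge> 2\<close> by auto
  have "(of_nat k - 1) * complex_of_real m = of_real ((real k - 1) * m)" by simp
  also have "\<dots> = 1" using k1 by (simp add: m_def)
  finally have km: "(of_nat k - 1) * complex_of_real m = 1" .
  \<comment> \<open>The claimed formula for \<open>z0\<close> solved for its error term, so the
    formula holds identically and only the order of \<open>E\<close> remains; it follows from
    differentiability of \<open>X\<close> at 0.\<close>
  define E where "E = (\<lambda>q. - (of_nat k - 1) * x0 a k q - 1)"
  have E_eq: "z0 a k q = - ((1 + E q) / ((of_nat k - 1) * (q ^ a)\<^sup>2))" for q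
  proof -
    have "1 + E q = - ((of_nat k - 1) * x0 a k q)" by (simp add: E_def algebra_simps)
    then show ?thesis using kc by (simp add: z0_def)
  qed
  have "E \<in> O[at 0](\<lambda>q. q ^ a)"
  proof -
    have "(X has_field_derivative deriv X 0) (at 0)"
      by (rule holomorphic_derivI[OF X open_ball]) (use \<delta>(1) in simp)
    then have "((\<lambda>Q. (X Q - X 0) / Q) \<longlongrightarrow> deriv X 0) (at 0)"
      by (simp add: DERIV_def)
    then have "(\<lambda>Q. X Q - X 0) \<in> O[at 0](\<lambda>Q. Q)"
      by (rule bigoI_tendsto) (simp add: eventually_at_filter)
    moreover have "filterlim (\<lambda>q::complex. q ^ a) (at 0) (at 0)"
      using \<open>a \<ge> 2\<close> by (intro filterlim_atI) (auto intro!: tendsto_eq_intros simp: eventually_at_filter)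
    ultimately have "(\<lambda>q. X (q ^ a) - X 0) \<in> O[at 0](\<lambda>q. q ^ a)"
      by (rule landau_o.big.compose)
    then have "(\<lambda>q. - (of_nat k - 1) * (X (q ^ a) - X 0)) \<in> O[at 0](\<lambda>q. q ^ a)"
      using kc by (subst landau_o.big.cmult_in_iff) auto
    moreover have "\<forall>\<^sub>F q in at 0. - (of_nat k - 1) * (X (q ^ a) - X 0) = E q"
      using small
    proof eventually_elim
      case (elim q)
      then have "norm q < \<delta>" "norm q \<le> r" using \<delta>(2) by (auto simp: \<epsilon>_def)
      then have "norm (q ^ a) < \<delta>"
        using P.norm_power_le_r(2)[of q a] \<open>a \<ge> 2\<close> by simp
      then have "x0 a k q = X (q ^ a)" by (rule x0)
      moreover have "- (of_nat k - 1) * (X (q ^ a) - X 0)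
          = - (of_nat k - 1) * X (q ^ a) - (of_nat k - 1) * complex_of_real m"
        unfolding X0' by (simp add: algebra_simps)
      ultimately show ?case unfolding E_def km by simp
    qed
    ultimately show ?thesis
      by (rule landau_o.big.in_cong[THEN iffD1, rotated])
  qed
  have asymptotics: "\<forall>\<^sub>F q in at_right (0::real).
       z0 a k (of_real q) \<in> \<real> \<and> Re (z0 a k (of_real q)) < -1 \<and>
       (\<forall>r0::real. norm (z0 a k (of_real q)) < r0 \<and> r0 < c / (q ^ a)\<^sup>2 \<longrightarrow>
          (\<lambda>d. W a d (of_real q) k - T a k (of_real q) - main_term a k (of_real q) d)
            \<in> O(\<lambda>d. of_real r0 powi (- int d))) \<and>
       (\<forall>\<^sub>F d in sequentially.
          main_term a k (of_real q) d \<in> \<real> \<and>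
          sgn (Re (main_term a k (of_real q) d)) = (-1) ^ (d - 1))"
    using eventually_at_right_real[OF \<epsilon>]
  proof eventually_elim
    case (elim q)
    then interpret S: pole_setting k r a c "of_real q" "X (of_real q ^ a)" by (intro setting) auto
    have real: "complex_of_real q \<in> \<real>" by simp
    have nQ: "norm (complex_of_real q ^ a) = q ^ a" using elim by (simp add: norm_power)
    obtain t where t: "t > 1" "z0 a k (of_real q) = of_real (- t)"
      using S.\<zeta>_real_less[OF real] .
    have "\<forall>\<^sub>F d in sequentially. main_term a k (of_real q) d \<in> \<real> \<and>
        sgn (Re (main_term a k (of_real q) d)) = (-1) ^ (d - 1)"
      using S.main_term_sign[OF real] by (intro eventually_sequentiallyI[of 1]) auto
    moreover have "(\<lambda>d. W a d (of_real q) k - T a k (of_real q) - main_term a k (of_real q) d)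
        \<in> O(\<lambda>d. of_real r0 powi (- int d))"
      if "norm (z0 a k (of_real q)) < r0 \<and> r0 < c / (q ^ a)\<^sup>2" for r0
      using S.W_asymptotics[of r0] that unfolding nQ by blast
    moreover have "z0 a k (of_real q) \<in> \<real>" "Re (z0 a k (of_real q)) < -1"
      using t by auto
    ultimately show ?case by blast
  qed
  have "eval_fps (complex_fps (x0_fps k)) analytic_on {0}"
    using analytic_on_eval_fps[of "\<lambda>z. z" "{0}" "complex_fps (x0_fps k)"] radius_pos
    by (simp add: zero_ereal_def)
  with radius_pos poles \<open>E \<in> O[at 0](\<lambda>q. q ^ a)\<close> E_eq asymptotics show ?thesis
    by (intro conjI exI[of _ E]) (auto intro: always_eventually)
qed

end
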